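(* Let the scalar field be $\mathbb{R}$, let $0<\alpha<\omega_1$ be a countable ordinal, and let $K$ be a compact Hausdorff space with $K^{(\alpha)}\neq\varnothing$. Let $\beta\in\omega_1$ be such that $\omega^\beta\le\alpha<\omega^{\beta+1}$. Then $C(K)$ contains an isometric SPR copy of $C[1,\omega^\gamma]$ for every ordinal $\gamma<\omega^\beta$. Moreover, if $\omega^\beta\cdot 2\le\alpha$, then $C(K)$ contains an isomorphic SPR copy of $C[1,\omega^\alpha]$.
   Context: $C(K)$ is the space of real-valued continuous functions on $K$ with the supremum norm. A linear subspace $E$ of $C(K)$ does $C$-stable phase retrieval ($C$-SPR), for a constant $C\ge1$, if $\min\{\|f-g\|,\|f+g\|\}\le C\,\big\||f|-|g|\big\|$ for all $f,g\in E$; it does SPR if it does $C$-SPR for some $C\ge1$. $C(K)$ contains an isometric (resp. isomorphic) SPR copy of a Banach space $X$ if there is a linear isometric embedding (resp. a linear isomorphism onto its range) $X\to C(K)$ whose range does SPR. Cantor--Bendixson derivatives: for a topological space $T$, $T'$ is the set of its non-isolated points; $K^{(0)}=K$, $K^{(\alpha+1)}=(K^{(\alpha)})'$ (with $K^{(\alpha)}$ in the subspace topology), and $K^{(\alpha)}=\bigcap_{\beta<\alpha}K^{(\beta)}$ for limit ordinals $\alpha$. $\omega_1$ is the first uncountable ordinal, operations are ordinal arithmetic, and $[1,\omega^\alpha]$ is the set of ordinals $\beta$ with $1\le\beta\le\omega^\alpha$ with the order topology. *)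

theory Defs
  imports "HOL-Analysis.Analysis" "HOL-Library.Countable_Set_Type"
begin

section \<open>Countable ordinals\<close>

text \<open>
  The elements of the well-order of the first uncountable cardinal are exactly the
  countable ordinals (each element standing for the order type of the set of its predecessors),
  so the type below is the ordinal \<open>\<omega>\<^sub>1\<close>.
\<close>

unbundle cardinal_syntax

lemma Card_order_omega1: "Card_order (cardSuc natLeq)"
  by (rule cardSuc_Card_order[OF natLeq_Card_order])

lemma Well_order_omega1: "Well_order (cardSuc natLeq)"
  by (rule cardSuc_Well_order[OF natLeq_Card_order])

lemma uncountable_Field_omega1: "uncountable (Field (cardSuc natLeq))"
proof
  assume "countable (Field (cardSuc natLeq))"
  then have "|Field (cardSuc natLeq)| \<le>o natLeq"
    by (simp add: countable_card_le_natLeq)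
  moreover have "cardSuc natLeq =o |Field (cardSuc natLeq)|"
    using Card_order_omega1 card_of_Field_ordIso ordIso_symmetric by blast
  ultimately have "cardSuc natLeq \<le>o natLeq"
    using ordIso_ordLeq_trans by blast
  with cardSuc_greater[OF natLeq_Card_order] show False
    using not_ordLess_ordLeq by blast
qed

typedef omega1 = "Field (cardSuc natLeq)"
proof -
  have "Field (cardSuc natLeq) \<noteq> {}"
    using uncountable_Field_omega1 by force
  then show ?thesis by blast
qed

instantiation omega1 :: linorder
begin

definition less_eq_omega1 :: "omega1 \<Rightarrow> omega1 \<Rightarrow> bool" where
  "a \<le> b \<longleftrightarrow> (Rep_omega1 a, Rep_omega1 b) \<in> cardSuc natLeq"

definition less_omega1 :: "omega1 \<Rightarrow> omega1 \<Rightarrow> bool" where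
  "a < b \<longleftrightarrow> a \<le> b \<and> \<not> b \<le> (a::omega1)"

instance
proof
  fix x y z :: omega1
  have lin: "Linear_order (cardSuc natLeq)"
    using Well_order_omega1 by (simp add: well_order_on_def)
  then have refl: "refl_on (Field (cardSuc natLeq)) (cardSuc natLeq)"
    and tr: "trans (cardSuc natLeq)" and an: "antisym (cardSuc natLeq)"
    and tot: "total_on (Field (cardSuc natLeq)) (cardSuc natLeq)"
    by (auto simp: order_on_defs)
  show "x < y \<longleftrightarrow> x \<le> y \<and> \<not> y \<le> x"
    by (rule less_omega1_def)
  show rf: "x \<le> x" for x :: omega1
    using refl Rep_omega1[of x] by (auto simp: less_eq_omega1_def refl_on_def)
  show "x \<le> y \<Longrightarrow> y \<le> z \<Longrightarrow> x \<le> z"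
    using tr by (auto simp: less_eq_omega1_def dest: transD)
  show "x \<le> y \<Longrightarrow> y \<le> x \<Longrightarrow> x = y"
    using an by (auto simp: less_eq_omega1_def Rep_omega1_inject dest: antisymD)
  show "x \<le> y \<or> y \<le> x"
    using tot rf[of x] Rep_omega1[of x] Rep_omega1[of y]
    by (cases "x = y") (auto simp: less_eq_omega1_def total_on_def Rep_omega1_inject)
qed

end

instance omega1 :: wellorder
proof (rule wf_wellorderI)
  have "wf (cardSuc natLeq - Id)"
    using Well_order_omega1 by (simp add: well_order_on_def)
  then have "wf (inv_image (cardSuc natLeq - Id) Rep_omega1)"
    by (rule wf_inv_image)
  moreover have "{(x, y). x < y} \<subseteq> inv_image (cardSuc natLeq - Id) Rep_omega1"
    by (auto simp: inv_image_def less_omega1_def less_eq_omega1_def Rep_omega1_inject)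
  ultimately show "wf {(x::omega1, y). x < y}"
    by (rule wf_subset)
qed intro_classes

lemma uncountable_UNIV_omega1: "uncountable (UNIV :: omega1 set)"
proof
  assume "countable (UNIV :: omega1 set)"
  then have "countable (range Rep_omega1)" by simp
  moreover have "range Rep_omega1 = Field (cardSuc natLeq)"
    using type_definition.Rep_range[OF type_definition_omega1] .
  ultimately show False using uncountable_Field_omega1 by simp
qed

lemma countable_lessThan_omega1: "countable {..<a::omega1}"
proof -
  let ?U = "underS (cardSuc natLeq) (Rep_omega1 a)"
  have "|?U| <o cardSuc natLeq"
    by (rule card_of_underS[OF Card_order_omega1 Rep_omega1])
  then have "countable ?U"
    using cardSuc_ordLeq_ordLess[OF natLeq_Card_order card_of_Card_order, of ?U]
    by (simp add: countable_card_le_natLeq)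
  moreover have "Rep_omega1 ` {..<a} \<subseteq> ?U"
    by (auto simp: underS_def less_omega1_def less_eq_omega1_def Rep_omega1_inject)
  ultimately have "countable (Rep_omega1 ` {..<a})"
    using countable_subset by blast
  then show ?thesis
    by (rule countable_image_inj_on) (auto simp: inj_on_def Rep_omega1_inject)
qed

lemma countable_bounded_omega1:
  assumes "countable (A :: omega1 set)"
  shows "\<exists>c. \<forall>x\<in>A. x < c"
proof (rule ccontr)
  assume "\<not> ?thesis"
  then have "UNIV \<subseteq> (\<Union>x\<in>A. insert x {..<x})"
    by (force simp: not_less le_less)
  moreover have "countable (\<Union>x\<in>A. insert x {..<x})"
    using assms countable_lessThan_omega1 by auto
  ultimately show False
    using uncountable_UNIV_omega1 countable_subset by blast
qed

unbundle no cardinal_syntax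

instantiation omega1 :: zero
begin
definition zero_omega1 :: omega1 where "(0::omega1) = (LEAST a. True)"
instance ..
end

lemma zero_le_omega1 [simp]: "0 \<le> (a::omega1)"
  unfolding zero_omega1_def by (rule Least_le) simp

definition osuc :: "omega1 \<Rightarrow> omega1" where
  "osuc a = (LEAST b. a < b)"

lemma less_osuc [simp]: "a < osuc a"
proof -
  have "\<exists>b. a < b" using countable_bounded_omega1[of "{a}"] by auto
  then show ?thesis unfolding osuc_def by (rule LeastI_ex)
qed

lemma osuc_le_iff: "osuc a \<le> b \<longleftrightarrow> a < b"
  using less_osuc[of a] by (auto simp: osuc_def intro: Least_le order.strict_trans2)

lemma osuc_inject [simp]: "osuc a = osuc b \<longleftrightarrow> a = b"
  by (metis less_osuc linorder_neqE not_le osuc_le_iff)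

lemma osuc_nonzero [simp]: "osuc a \<noteq> 0"
  by (metis less_osuc not_le zero_le_omega1)

definition osup :: "omega1 set \<Rightarrow> omega1" where
  "osup A = (LEAST c. \<forall>x\<in>A. x \<le> c)"

lemma osup_le_iff:
  assumes "countable A"
  shows "osup A \<le> c \<longleftrightarrow> (\<forall>x\<in>A. x \<le> c)"
proof -
  have "\<exists>c. \<forall>x\<in>A. x \<le> c" using countable_bounded_omega1[OF assms] by (meson less_imp_le)
  then have "\<forall>x\<in>A. x \<le> osup A" unfolding osup_def by (rule LeastI_ex)
  then show ?thesis by (auto simp: osup_def intro: Least_le order.trans)
qed

text \<open>
  Transfinite recursion: value \<open>z\<close> at 0, step \<open>s\<close> at successors, and at a limit the
  operation \<open>l\<close> applied to the set of all earlier values.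
\<close>

function ord_rec :: "'b \<Rightarrow> ('b \<Rightarrow> 'b) \<Rightarrow> ('b set \<Rightarrow> 'b) \<Rightarrow> omega1 \<Rightarrow> 'b" where
  "ord_rec z s l a =
     (if a = 0 then z
      else if \<exists>b. a = osuc b then s (ord_rec z s l (THE b. a = osuc b))
      else l (ord_rec z s l ` {..<a}))"
  by auto
termination
  by (relation "inv_image {(x, y). x < y} (\<lambda>(z, s, l, a). a)")
     (auto simp: wf)

declare ord_rec.simps [simp del]

definition olimit :: "omega1 \<Rightarrow> bool" where
  "olimit a \<longleftrightarrow> a \<noteq> 0 \<and> (\<forall>b. a \<noteq> osuc b)"

lemma ord_rec_0: "ord_rec z s l 0 = z"
  by (subst ord_rec.simps) simp

lemma ord_rec_osuc: "ord_rec z s l (osuc a) = s (ord_rec z s l a)"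
  by (subst ord_rec.simps) simp

lemma ord_rec_limit: "olimit a \<Longrightarrow> ord_rec z s l a = l (ord_rec z s l ` {..<a})"
  by (subst ord_rec.simps) (auto simp: olimit_def)

instantiation omega1 :: "{one, plus, times}"
begin

definition one_omega1 :: omega1 where "(1::omega1) = osuc 0"

definition plus_omega1 :: "omega1 \<Rightarrow> omega1 \<Rightarrow> omega1" where
  "a + b = ord_rec a osuc osup b"

definition times_omega1 :: "omega1 \<Rightarrow> omega1 \<Rightarrow> omega1" where
  "a * b = ord_rec 0 (\<lambda>x. x + a) osup b"

instance ..

end

definition omega :: omega1 where
  "omega = (LEAST a. olimit a)"

definition omega_pow :: "omega1 \<Rightarrow> omega1" where
  "omega_pow a = ord_rec 1 (\<lambda>x. x * omega) osup a"

lemma plus_omega1_rec: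
  "a + 0 = (a::omega1)"
  "a + osuc b = osuc (a + b)"
  "olimit b \<Longrightarrow> a + b = osup ((+) a ` {..<b})"
  by (simp_all add: plus_omega1_def[abs_def] ord_rec_0 ord_rec_osuc ord_rec_limit)

lemma times_omega1_rec:
  "a * 0 = (0::omega1)"
  "a * osuc b = a * b + a"
  "olimit b \<Longrightarrow> a * b = osup ((*) a ` {..<b})"
  by (simp_all add: times_omega1_def[abs_def] ord_rec_0 ord_rec_osuc ord_rec_limit)

lemma omega_pow_rec:
  "omega_pow 0 = 1"
  "omega_pow (osuc b) = omega_pow b * omega"
  "olimit b \<Longrightarrow> omega_pow b = osup (omega_pow ` {..<b})"
  by (simp_all add: omega_pow_def[abs_def] ord_rec_0 ord_rec_osuc ord_rec_limit)

lemma osuc_eq_plus_1: "osuc a = a + 1"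
  by (simp add: one_omega1_def plus_omega1_rec)

lemma olimit_omega: "olimit omega"
proof -
  define c where "c = (LEAST c. \<forall>n. (osuc ^^ n) 0 < c)"
  have "\<exists>c. \<forall>n. (osuc ^^ n) 0 < c"
    using countable_bounded_omega1[of "range (\<lambda>n. (osuc ^^ n) 0)"] by auto
  then have c: "(osuc ^^ n) 0 < c" for n
    using LeastI_ex[of "\<lambda>c. \<forall>n. (osuc ^^ n) 0 < c"] unfolding c_def by blast
  have "c \<noteq> osuc b" for b
  proof
    assume b: "c = osuc b"
    have "(osuc ^^ n) 0 < b" for n
    proof -
      have "osuc ((osuc ^^ n) 0) < osuc b" using c[of "Suc n"] b by simp
      then show ?thesis by (meson less_osuc not_le osuc_le_iff)
    qed
    then have "c \<le> b" unfolding c_def by (intro Least_le) simp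
    with b show False by (metis less_osuc not_le)
  qed
  moreover have "c \<noteq> 0" using c[of 0] by auto
  ultimately have "olimit c" by (simp add: olimit_def)
  then show ?thesis unfolding omega_def by (rule LeastI)
qed

instantiation omega1 :: linorder_topology
begin

definition open_omega1 :: "omega1 set \<Rightarrow> bool" where
  "open_omega1 = generate_topology (range lessThan \<union> range greaterThan)"

instance
  by intro_classes (simp add: open_omega1_def)

end

text \<open>
  Since an interval is convex, its subspace topology inherited from \<open>\<omega>\<^sub>1\<close> coincides
  with its own order topology.
\<close>

definition ord_interval :: "omega1 \<Rightarrow> omega1 topology" where
  "ord_interval a = top_of_set {1..a}"


section \<open>Cantor--Bendixson derivatives\<close>

definition nonisolated :: "'a topology \<Rightarrow> 'a set" where
  "nonisolated X = {x \<in> topspace X. \<not> openin X {x}}"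

definition cb_derivative :: "'a topology \<Rightarrow> omega1 \<Rightarrow> 'a set" where
  "cb_derivative X = ord_rec (topspace X) (\<lambda>S. nonisolated (subtopology X S)) Inter"

lemma cb_derivative_rec:
  "cb_derivative X 0 = topspace X"
  "cb_derivative X (osuc a) = nonisolated (subtopology X (cb_derivative X a))"
  "olimit a \<Longrightarrow> cb_derivative X a = (\<Inter>b\<in>{..<a}. cb_derivative X b)"
  by (simp_all add: cb_derivative_def ord_rec_0 ord_rec_osuc ord_rec_limit)


section \<open>Spaces of continuous functions and stable phase retrieval\<close>

text \<open>
  The functions in \<open>C(X)\<close> are represented by total functions that vanish off \<open>topspace X\<close>,
  so that equality and the vector space operations are those of plain pointwise functions.
\<close>

definition cspace :: "'a topology \<Rightarrow> ('a \<Rightarrow> real) set" where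
  "cspace X = {f. continuous_map X euclideanreal f \<and> (\<forall>x. x \<notin> topspace X \<longrightarrow> f x = 0)}"

text \<open>Only meaningful when \<open>topspace X\<close> is nonempty and \<open>f\<close> is bounded on it.\<close>

definition supnorm :: "'a topology \<Rightarrow> ('a \<Rightarrow> real) \<Rightarrow> real" where
  "supnorm X f = (SUP x\<in>topspace X. \<bar>f x\<bar>)"

definition cspace_subspace :: "'a topology \<Rightarrow> ('a \<Rightarrow> real) set \<Rightarrow> bool" where
  "cspace_subspace X E \<longleftrightarrow>
     E \<subseteq> cspace X \<and> (\<lambda>x. 0) \<in> E \<and>
     (\<forall>f\<in>E. \<forall>g\<in>E. \<forall>a b. (\<lambda>x. a * f x + b * g x) \<in> E)"

definition does_C_SPR :: "'a topology \<Rightarrow> real \<Rightarrow> ('a \<Rightarrow> real) set \<Rightarrow> bool" where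
  "does_C_SPR X C E \<longleftrightarrow>
     cspace_subspace X E \<and>
     (\<forall>f\<in>E. \<forall>g\<in>E.
        min (supnorm X (\<lambda>x. f x - g x)) (supnorm X (\<lambda>x. f x + g x))
          \<le> C * supnorm X (\<lambda>x. \<bar>f x\<bar> - \<bar>g x\<bar>))"

definition does_SPR :: "'a topology \<Rightarrow> ('a \<Rightarrow> real) set \<Rightarrow> bool" where
  "does_SPR X E \<longleftrightarrow> (\<exists>C\<ge>1. does_C_SPR X C E)"

definition linear_cspace ::
    "'b topology \<Rightarrow> 'a topology \<Rightarrow> (('b \<Rightarrow> real) \<Rightarrow> ('a \<Rightarrow> real)) \<Rightarrow> bool" where
  "linear_cspace L K T \<longleftrightarrow>
     T ` cspace L \<subseteq> cspace K \<and>
     (\<forall>f\<in>cspace L. \<forall>g\<in>cspace L. \<forall>a b.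
        T (\<lambda>x. a * f x + b * g x) = (\<lambda>y. a * T f y + b * T g y))"

definition isometric_embedding ::
    "'b topology \<Rightarrow> 'a topology \<Rightarrow> (('b \<Rightarrow> real) \<Rightarrow> ('a \<Rightarrow> real)) \<Rightarrow> bool" where
  "isometric_embedding L K T \<longleftrightarrow>
     linear_cspace L K T \<and> (\<forall>f\<in>cspace L. supnorm K (T f) = supnorm L f)"

text \<open>An isomorphism onto the range: injective, with \<open>T\<close> and its inverse on the range bounded.\<close>

definition isomorphic_embedding ::
    "'b topology \<Rightarrow> 'a topology \<Rightarrow> (('b \<Rightarrow> real) \<Rightarrow> ('a \<Rightarrow> real)) \<Rightarrow> bool" where
  "isomorphic_embedding L K T \<longleftrightarrow>
     linear_cspace L K T \<and> inj_on T (cspace L) \<and>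
     (\<exists>M. \<forall>f\<in>cspace L. supnorm K (T f) \<le> M * supnorm L f) \<and>
     (\<exists>M. \<forall>h\<in>T ` cspace L. supnorm L (inv_into (cspace L) T h) \<le> M * supnorm K h)"

text \<open>Here \<open>C(K)\<close> contains a copy of the Banach space \<open>C(L)\<close>.\<close>

definition has_isometric_SPR_copy :: "'a topology \<Rightarrow> 'b topology \<Rightarrow> bool" where
  "has_isometric_SPR_copy K L \<longleftrightarrow>
     (\<exists>T. isometric_embedding L K T \<and> does_SPR K (T ` cspace L))"

definition has_isomorphic_SPR_copy :: "'a topology \<Rightarrow> 'b topology \<Rightarrow> bool" where
  "has_isomorphic_SPR_copy K L \<longleftrightarrow>
     (\<exists>T. isomorphic_embedding L K T \<and> does_SPR K (T ` cspace L))"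

end

theory Submission
  imports Defs
begin

text \<open>
  Since \<open>\<bar>\<bar>u\<bar> - \<bar>v\<bar>\<bar> = min \<bar>u - v\<bar> \<bar>u + v\<bar>\<close>, a linear map \<open>T\<close> from \<open>C(L)\<close> to \<open>C(K)\<close> that is bounded by the
  supremum norm has an SPR range (with constant 3) as soon as every average \<open>(f s + f t) / 2\<close> is the
  value of \<open>T f\<close> at a point of \<open>K\<close> not depending on \<open>f\<close>: if \<open>\<bar>p s\<bar>\<close> and \<open>\<bar>q t\<bar>\<close> exceed \<open>3 D\<close> while
  \<open>min \<bar>T p\<bar> \<bar>T q\<bar> \<le> D\<close> everywhere, then \<open>\<bar>q s\<bar>\<close> and \<open>\<bar>p t\<bar>\<close> are at most \<open>D\<close>, and both averages exceed
  \<open>D\<close> in absolute value. So one has to embed averages over \<open>L \<times> L\<close>, a space whose Cantor-Bendixson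
  rank is the natural sum of two copies of the rank of \<open>L\<close>; it stays below \<open>\<omega>\<^sup>\<beta>\<close> for ranks below
  \<open>\<omega>\<^sup>\<beta>\<close>, and is \<open>\<omega>\<^sup>\<beta> \<cdot> 2\<close> for rank \<open>\<omega>\<^sup>\<beta>\<close>. The embedding is built by well-founded recursion: around a
  point of \<open>K\<^sup>(\<^sup>\<eta>\<^sup>)\<close> take a bump function carrying the value at the root, and inside it disjoint open
  sets meeting the derivatives of lower rank, which carry the subtrees.

  For the isomorphic copy, \<open>[1, \<omega>\<^sup>\<alpha>]\<close> with \<open>\<alpha> < \<omega>\<^sup>\<beta> \<cdot> n\<close> is cut into countably many blocks of rank below
  \<open>\<omega>\<^sup>\<beta>\<close> such that every point is joined to the top by a bounded number of blocks. The increments of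
  a continuous function over the blocks tend to 0 uniformly, so they form a continuous function on
  a tree of rank \<open>\<omega>\<^sup>\<beta>\<close>, and the passage to increments is an isomorphism onto its range.
\<close>


section \<open>Ordinal arithmetic and natural sums\<close>

lemma omega1_cases:
  obtains "a = (0::omega1)" | b where "a = osuc b" | "olimit a"
  unfolding olimit_def by blast

lemma less_osuc_iff: "a < osuc b \<longleftrightarrow> a \<le> b"
  using osuc_le_iff[of b a] by (simp add: not_le[symmetric])

lemma pos_omega1_iff: "0 < (a::omega1) \<longleftrightarrow> a \<noteq> 0"
  by (simp add: less_le)

lemma not_less_zero_omega1 [simp]: "\<not> a < (0::omega1)"
  by (simp add: not_less)

lemma olimit_osuc_less: "olimit a \<Longrightarrow> b < a \<Longrightarrow> osuc b < a"
  by (metis le_less olimit_def osuc_le_iff)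

lemma olimit_pos: "olimit a \<Longrightarrow> 0 < a"
  by (simp add: olimit_def pos_omega1_iff)

lemma less_osup_iff: "countable A \<Longrightarrow> c < osup A \<longleftrightarrow> (\<exists>x\<in>A. c < x)"
  using osup_le_iff[of A c] by (auto simp: not_le[symmetric])

lemma less_osup_image_iff: "c < osup (F ` {..<a}) \<longleftrightarrow> (\<exists>b<a. c < F b)" for a :: omega1
  by (subst less_osup_iff) (auto intro: countable_lessThan_omega1)

text \<open>Only the limit step needs care: if a lies below a limit b, so does
  \<open>osuc a\<close>, and \<open>F (osuc a)\<close>, already above \<open>F a\<close>, is among
  the values under the supremum.\<close>

lemma normal_function_less:
  fixes F :: "omega1 \<Rightarrow> omega1"
  assumes suc: "\<And>b. F b < F (osuc b)" and lim: "\<And>b. olimit b \<Longrightarrow> F b = osup (F ` {..<b})"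
    and "a < b"
  shows "F a < F b"
  using \<open>a < b\<close>
proof (induction b rule: less_induct)
  case (less b)
  show ?case
  proof (cases b rule: omega1_cases)
    case (2 c)
    then show ?thesis
      using less suc[of c] by (metis le_less less_osuc less_osuc_iff order.strict_trans)
  next
    case 3
    then have "osuc a < b" using less.prems olimit_osuc_less by blast
    then show ?thesis
      using suc[of a] by (auto simp: lim[OF 3] less_osup_image_iff)
  qed (use less in auto)
qed

lemma plus_omega1_less: "b < c \<Longrightarrow> a + b < a + (c::omega1)"
  by (rule normal_function_less[of "(+) a"]) (simp_all add: plus_omega1_rec)

lemma plus_omega1_less_iff [simp]: "a + b < a + c \<longleftrightarrow> b < (c::omega1)"
  by (metis linorder_neqE not_less_iff_gr_or_eq plus_omega1_less)

lemma le_plus_omega1: "a \<le> a + (b::omega1)"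
  by (metis less_le not_less_zero_omega1 order.refl plus_omega1_less plus_omega1_rec(1) not_less)

text \<open>Stands in for left subtraction: later inductions use it to locate an ordinal within one
  of the two parts of a sum.\<close>

lemma less_plus_omega1_cases:
  assumes "x < a + (b::omega1)"
  obtains "x < a" | c where "c < b" "x = a + c"
proof -
  have "x < a \<or> (\<exists>c<b. x = a + c)"
    using assms
  proof (induction b rule: less_induct)
    case (less b)
    show ?case
    proof (cases b rule: omega1_cases)
      case 1
      then show ?thesis using less.prems by (simp add: plus_omega1_rec)
    next
      case (2 c)
      then have "x < a + c \<or> x = a + c"
        using less.prems by (auto simp: plus_omega1_rec less_osuc_iff)
      then show ?thesis
        using less.IH[of c] 2 less_osuc[of c] order.strict_trans[OF _ less_osuc[of c]] by metis
    next
      case 3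
      then obtain c where "c < b" "x < a + c"
        using less.prems by (auto simp: plus_omega1_rec less_osup_image_iff)
      then show ?thesis
        using less.IH[of c] by (blast intro: order.strict_trans)
    qed
  qed
  then show thesis using that by blast
qed

lemma zero_plus_omega1 [simp]: "0 + a = (a::omega1)"
proof (induction a rule: less_induct)
  case (less a)
  show ?case
  proof (cases a rule: omega1_cases)
    case (2 b)
    then show ?thesis using less by (simp add: plus_omega1_rec)
  next
    case 3
    have "c < 0 + a \<longleftrightarrow> c < a" for c
      unfolding plus_omega1_rec(3)[OF 3] less_osup_image_iff
      using less olimit_osuc_less[OF 3] by (metis less_osuc order.strict_trans)
    then show ?thesis by (metis linorder_neqE order.irrefl)
  qed (simp add: plus_omega1_rec)
qed

section \<open>Finite multiples and powers of omega\<close>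

primrec omult :: "omega1 \<Rightarrow> nat \<Rightarrow> omega1" where
  "omult a 0 = 0"
| "omult a (Suc n) = omult a n + a"

lemma times_finite_omega1: "a * (osuc ^^ n) 0 = omult a n"
  by (induction n) (simp_all add: times_omega1_rec)

text \<open>\<open>omega\<close> is the least limit, so a descent through predecessors from anything
  below it can only stop at 0.\<close>

lemma less_omega_iff: "a < omega \<longleftrightarrow> (\<exists>n. a = (osuc ^^ n) 0)"
proof
  show "a < omega \<Longrightarrow> \<exists>n. a = (osuc ^^ n) 0"
  proof (induction a rule: less_induct)
    case (less a)
    show ?case
    proof (cases a rule: omega1_cases)
      case 1
      then show ?thesis by (intro exI[of _ 0]) simp
    next
      case (2 b)
      then obtain n where "b = (osuc ^^ n) 0"
        using less.IH[of b] less.prems order.strict_trans[OF less_osuc[of b], of omega] by auto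
      then show ?thesis using 2 by (intro exI[of _ "Suc n"]) simp
    next
      case 3
      then show ?thesis using less.prems not_less_Least unfolding omega_def by blast
    qed
  qed
  have "(osuc ^^ n) 0 < omega" for n
    by (induction n) (auto intro: olimit_osuc_less olimit_pos olimit_omega)
  then show "\<exists>n. a = (osuc ^^ n) 0 \<Longrightarrow> a < omega" by blast
qed

lemma less_times_omega_iff: "x < a * omega \<longleftrightarrow> (\<exists>n. x < omult a n)"
proof -
  have "x < a * omega \<longleftrightarrow> (\<exists>b<omega. x < a * b)"
    by (simp add: times_omega1_rec(3)[OF olimit_omega] less_osup_image_iff)
  then show ?thesis
    by (metis less_omega_iff times_finite_omega1)
qed

lemma strict_mono_omult: "0 < a \<Longrightarrow> strict_mono (omult a)"
  unfolding strict_mono_Suc_iff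
  by (metis omult.simps(2) plus_omega1_less plus_omega1_rec(1))

lemma omult_mono: "m \<le> n \<Longrightarrow> omult a m \<le> omult a n"
  by (rule lift_Suc_mono_le[of "omult a"]) (simp_all add: le_plus_omega1)

lemma omult_plus_less: "m < n \<Longrightarrow> b < a \<Longrightarrow> omult a m + b < omult a n"
  by (metis Suc_leI omult.simps(2) omult_mono order.strict_trans2 plus_omega1_less)

text \<open>Division by a with remainder; the quotient is a natural number because x lies below a
  finite multiple.\<close>

lemma less_omult_cases:
  assumes "x < omult a n"
  obtains m b where "m < n" "b < a" "x = omult a m + b"
proof -
  have "\<exists>m<n. \<exists>b<a. x = omult a m + b"
    using assms
  proof (induction n)
    case (Suc n)
    then have "x < omult a n + a" by simp
    then show ?case
      by (rule less_plus_omega1_cases) (use Suc.IH less_SucI in blast)+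
  qed simp
  then show thesis using that by blast
qed

lemma omega_pow_pos: "0 < omega_pow a"
  and omega_pow_less_osuc: "omega_pow a < omega_pow (osuc a)"
proof -
  \<comment> \<open>Two copies suffice as witness: x < x + x for positive x.\<close>
  have less: "x < x * omega" if "0 < x" for x
    using strict_mono_omult[OF that] unfolding less_times_omega_iff
    by (intro exI[of _ "Suc (Suc 0)"]) (use plus_omega1_less[OF that, of x] in \<open>simp add: plus_omega1_rec\<close>)
  show pos: "0 < omega_pow a" for a
  proof (induction a rule: less_induct)
    case (less a)
    show ?case
    proof (cases a rule: omega1_cases)
      case 1
      then show ?thesis by (simp add: omega_pow_rec one_omega1_def)
    next
      case (2 b)
      then show ?thesis
        using less[of b] \<open>\<And>x. 0 < x \<Longrightarrow> x < x * omega\<close>[of "omega_pow b"]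
        by (simp add: omega_pow_rec)
    next
      case 3
      then show ?thesis
        using less[of 0] olimit_pos[OF 3] by (auto simp: omega_pow_rec(3) less_osup_image_iff)
    qed
  qed
  show "omega_pow a < omega_pow (osuc a)" for a
    using less[OF pos] by (simp add: omega_pow_rec)
qed

lemma omega_pow_less: "a < b \<Longrightarrow> omega_pow a < omega_pow b"
  by (rule normal_function_less[of omega_pow])
     (simp_all only: omega_pow_less_osuc omega_pow_rec(3))

lemma omega_pow_mono: "a \<le> b \<Longrightarrow> omega_pow a \<le> omega_pow b"
  using omega_pow_less[of a b] by (auto simp: le_less)

lemma less_omega_pow_osuc_iff: "x < omega_pow (osuc a) \<longleftrightarrow> (\<exists>n. x < omult (omega_pow a) n)"
  by (simp add: omega_pow_rec less_times_omega_iff)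

text \<open>The predecessors are countably many, so an enumeration \<open>e\<close> of them can be
  turned into an increasing cofinal sequence.\<close>

lemma olimit_cofinal_sequence:
  assumes "olimit a"
  obtains s :: "nat \<Rightarrow> omega1"
  where "strict_mono s" "\<And>n. s n < a" "\<And>x. x < a \<Longrightarrow> \<exists>n. x < s n"
proof -
  define e where "e = from_nat_into {..<a}"
  have ne: "{..<a} \<noteq> {}" using olimit_pos[OF assms] by blast
  have e: "e n < a" for n using from_nat_into[OF ne] unfolding e_def by blast
  \<comment> \<open>\<open>osuc\<close> makes the sequence increase strictly and pass
    \<open>e n\<close>; a limit ordinal is closed under this step.\<close>
  define s where "s = rec_nat 0 (\<lambda>n x. osuc (max x (e n)))"
  have s: "s 0 = 0" "s (Suc n) = osuc (max (s n) (e n))" for n by (simp_all add: s_def)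
  show thesis
  proof
    show "strict_mono s"
      unfolding strict_mono_Suc_iff s by (simp add: less_osuc_iff)
    show "s n < a" for n
      by (induction n) (auto simp: s max_def e intro: olimit_osuc_less olimit_pos assms)
    fix x assume "x < a"
    then obtain n where "e n = x"
      using from_nat_into_surj[OF countable_lessThan_omega1, of x a] unfolding e_def by auto
    then show "\<exists>n. x < s n"
      by (intro exI[of _ "Suc n"]) (simp add: s less_osuc_iff)
  qed
qed

section \<open>Natural sums below powers of omega\<close>

text \<open>\<open>nsum a b c\<close> says that the natural (Hessenberg) sum of \<open>a\<close> and \<open>b\<close> is at most \<open>c\<close>.\<close>

inductive nsum :: "omega1 \<Rightarrow> omega1 \<Rightarrow> omega1 \<Rightarrow> bool" where
  "(\<And>a'. a' < a \<Longrightarrow> \<exists>c'<c. nsum a' b c') \<Longrightarrow> (\<And>b'. b' < b \<Longrightarrow> \<exists>c'<c. nsum a b' c') \<Longrightarrow> nsum a b c"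

lemma nsum_less_left: "nsum a b c \<Longrightarrow> a' < a \<Longrightarrow> \<exists>c'<c. nsum a' b c'"
  by (auto elim: nsum.cases)

lemma nsum_less_right: "nsum a b c \<Longrightarrow> b' < b \<Longrightarrow> \<exists>c'<c. nsum a b' c'"
  by (auto elim: nsum.cases)

lemma nsum_zero: "nsum 0 0 c"
  by (rule nsum.intros) simp_all

text \<open>Coefficients of w and remainders add separately, as closure of w under natural sums
  prevents a carry. Going below x either shrinks the remainder or drops the coefficient; in the
  second case the new remainder is arbitrary below w, but the lost copy of w outweighs it.\<close>

lemma nsum_omult_plus:
  assumes closed: "\<And>a b. a < w \<Longrightarrow> b < w \<Longrightarrow> \<exists>c<w. nsum a b c"
    and "nsum a b c" "a < w" "b < w"
  shows "nsum (omult w m + a) (omult w n + b) (omult w (m + n) + c)"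
proof -
  \<comment> \<open>The induction is on the sums x and y themselves with the decompositions left
    free, because a smaller ordinal may have a new coefficient and a new remainder.\<close>
  have "nsum x y (omult w (m + n) + c)"
    if "x = omult w m + a" "y = omult w n + b" "nsum a b c" "a < w" "b < w"
    for x y a b c m n
    using that
  proof (induction x arbitrary: y a b c m n rule: less_induct)
    case outer: (less x)
    show ?case
      using outer.prems
    proof (induction y arbitrary: b c n rule: less_induct)
      case inner: (less y)
      show ?case
      proof (rule nsum.intros)
        fix x' assume "x' < x"
        then have "x' < omult w m + a" using inner.prems by simp
        then show "\<exists>c'<omult w (m + n) + c. nsum x' y c'"
        proof (rule less_plus_omega1_cases)
          assume "x' < omult w m"
          then obtain k a' where k: "k < m" "a' < w" "x' = omult w k + a'"
            by (rule less_omult_cases)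
          then obtain c' where "c' < w" "nsum a' b c'" using closed inner.prems by blast
          then have "nsum x' y (omult w (k + n) + c')"
            using outer.IH[OF \<open>x' < x\<close>] k inner.prems by blast
          moreover have "omult w (k + n) + c' < omult w (m + n) + c"
            using omult_plus_less[of "k + n" "m + n" c' w] k \<open>c' < w\<close>
            by (metis add_less_cancel_right le_plus_omega1 order.strict_trans2)
          ultimately show ?thesis by blast
        next
          fix a' assume "a' < a" and x': "x' = omult w m + a'"
          then obtain c' where "c' < c" "nsum a' b c'"
            using nsum_less_left inner.prems by blast
          then have "nsum x' y (omult w (m + n) + c')"
            using outer.IH[OF \<open>x' < x\<close> x'] order.strict_trans[OF \<open>a' < a\<close>] inner.prems by metis
          then show ?thesis using \<open>c' < c\<close> plus_omega1_less by blast
        qed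
      next
        fix y' assume "y' < y"
        then have "y' < omult w n + b" using inner.prems by simp
        then show "\<exists>c'<omult w (m + n) + c. nsum x y' c'"
        proof (rule less_plus_omega1_cases)
          assume "y' < omult w n"
          then obtain k b' where k: "k < n" "b' < w" "y' = omult w k + b'"
            by (rule less_omult_cases)
          then obtain c' where "c' < w" "nsum a b' c'" using closed inner.prems by blast
          then have "nsum x y' (omult w (m + k) + c')"
            using inner.IH[OF \<open>y' < y\<close>] k inner.prems by blast
          moreover have "omult w (m + k) + c' < omult w (m + n) + c"
            using omult_plus_less[of "m + k" "m + n" c' w] k \<open>c' < w\<close>
            by (metis add_less_cancel_left le_plus_omega1 order.strict_trans2)
          ultimately show ?thesis by blast
        next
          fix b' assume "b' < b" and y': "y' = omult w n + b'"
          then obtain c' where "c' < c" "nsum a b' c'"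
            using nsum_less_right inner.prems by blast
          then have "nsum x y' (omult w (m + n) + c')"
            using inner.IH[OF \<open>y' < y\<close> _ y'] order.strict_trans[OF \<open>b' < b\<close>] inner.prems by metis
          then show ?thesis using \<open>c' < c\<close> plus_omega1_less by blast
        qed
      qed
    qed
  qed
  then show ?thesis using assms by blast
qed

text \<open>At a successor exponent both arguments are finite multiples of the previous power plus
  remainders, and \<open>nsum_omult_plus\<close> adds them; at a limit exponent both lie below a
  single smaller power.\<close>

lemma nsum_closed_omega_pow:
  "a < omega_pow g \<Longrightarrow> b < omega_pow g \<Longrightarrow> \<exists>c<omega_pow g. nsum a b c"
proof (induction g arbitrary: a b rule: less_induct)
  case (less g)
  show ?case
  proof (cases g rule: omega1_cases)
    case 1
    then have "a = 0" "b = 0"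
      using less.prems by (auto simp: omega_pow_rec one_omega1_def less_osuc_iff antisym)
    then show ?thesis using nsum_zero omega_pow_pos by blast
  next
    case (2 h)
    let ?w = "omega_pow h"
    have split: "\<exists>m z. z < ?w \<and> x = omult ?w m + z" if "x < omega_pow g" for x
      using that less_omult_cases unfolding 2 less_omega_pow_osuc_iff by metis
    obtain m a' n b' where ab: "a' < ?w" "a = omult ?w m + a'" "b' < ?w" "b = omult ?w n + b'"
      using split[OF less.prems(1)] split[OF less.prems(2)] by blast
    have closed: "\<And>a b. a < ?w \<Longrightarrow> b < ?w \<Longrightarrow> \<exists>c<?w. nsum a b c"
      using less.IH[of h] 2 by simp
    then obtain c where c: "c < ?w" "nsum a' b' c" using ab by blast
    have "nsum a b (omult ?w (m + n) + c)"
      using nsum_omult_plus[OF closed c(2)] ab by simp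
    moreover have "omult ?w (m + n) + c < omega_pow g"
      unfolding 2 less_omega_pow_osuc_iff using omult_plus_less[OF lessI c(1)] by blast
    ultimately show ?thesis by blast
  next
    case 3
    obtain h1 h2 where h: "h1 < g" "a < omega_pow h1" "h2 < g" "b < omega_pow h2"
      using less.prems unfolding omega_pow_rec(3)[OF 3] less_osup_image_iff by blast
    have "omega_pow h1 \<le> omega_pow (max h1 h2)" "omega_pow h2 \<le> omega_pow (max h1 h2)"
      by (rule omega_pow_mono, simp)+
    then obtain c where "c < omega_pow (max h1 h2)" "nsum a b c"
      using less.IH[of "max h1 h2" a b] h
        order.strict_trans2[of a "omega_pow h1"] order.strict_trans2[of b "omega_pow h2"] by auto
    then show ?thesis
      using order.strict_trans[OF _ omega_pow_less[of "max h1 h2" g]] h by auto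
  qed
qed

text \<open>The case of coefficients 1 and remainders 0 in \<open>nsum_omult_plus\<close>.\<close>

lemma nsum_omega_pow_double: "nsum (omega_pow b) (omega_pow b) (omega_pow b * (1 + 1))"
proof -
  let ?w = "omega_pow b"
  have "nsum (omult ?w 1 + 0) (omult ?w 1 + 0) (omult ?w (1 + 1) + 0)"
    by (rule nsum_omult_plus[OF nsum_closed_omega_pow nsum_zero]) (auto intro: omega_pow_pos)
  moreover have "(1 + 1 :: omega1) = (osuc ^^ 2) 0"
    by (simp add: one_omega1_def plus_omega1_rec numeral_2_eq_2)
  ultimately show ?thesis
    by (simp only: times_finite_omega1) (simp add: plus_omega1_rec numeral_2_eq_2)
qed

section \<open>Ordinal intervals as well-founded trees\<close>

text \<open>\<open>oseg g a b\<close> exhibits the interval \<open>{a<..b}\<close> as a tree of rank at most \<open>g\<close> with root \<open>b\<close>.\<close>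

inductive oseg :: "omega1 \<Rightarrow> omega1 \<Rightarrow> omega1 \<Rightarrow> bool" where
  osuc: "oseg g a (osuc a)"
| seq: "strict_mono c \<Longrightarrow> (\<And>n. c n < b) \<Longrightarrow> (\<And>x. x < b \<Longrightarrow> \<exists>n. x < c n) \<Longrightarrow> (\<And>n. h n < g) \<Longrightarrow>
    (\<And>n::nat. oseg (h n) (c n) (c (Suc n))) \<Longrightarrow> a = c 0 \<Longrightarrow> oseg g a b"

lemma oseg_shift: "oseg g a b \<Longrightarrow> oseg g (d + a) (d + b)"
proof (induction rule: oseg.induct)
  case (osuc g a)
  then show ?case by (simp add: plus_omega1_rec oseg.osuc)
next
  case (seq c b h g a)
  show ?case
  proof (rule oseg.seq[of "\<lambda>n. d + c n" _ h])
    show "\<exists>n. x < d + c n" if "x < d + b" for x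
      using that
    proof (rule less_plus_omega1_cases)
      show "\<exists>n. x < d + c n" if "x < d"
        using that le_plus_omega1 order.strict_trans2 by blast
      show "\<exists>n. x < d + c n" if "y < b" "x = d + y" for y
        using that seq(3) by auto
    qed
  qed (use seq in \<open>auto simp: strict_mono_def\<close>)
qed

text \<open>The block that is cut is treated by induction, the blocks before it are dropped, the
  later ones kept. This supplies the blocks between successive powers in the limit case of
  \<open>oseg_omega_pow\<close>.\<close>

lemma oseg_tail: "oseg g a b \<Longrightarrow> a \<le> a' \<Longrightarrow> a' < b \<Longrightarrow> oseg g a' b"
proof (induction arbitrary: a' rule: oseg.induct)
  case (osuc g a)
  then have "a' = a" by (simp add: less_osuc_iff)
  then show ?case by (simp add: oseg.osuc)
next
  case (seq c b h g a)
  define j where "j = (LEAST n. a' < c n)"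
  have j: "a' < c j" unfolding j_def using seq.hyps(3)[OF seq.prems(2)] by (rule LeastI_ex)
  have "j \<noteq> 0" using j seq.prems(1) seq.hyps(6) by (metis not_less)
  then obtain k where k: "j = Suc k" by (cases j) auto
  have "c k \<le> a'"
    using not_less_Least[of k "\<lambda>n. a' < c n"] k unfolding j_def by simp
  \<comment> \<open>The new sequence starts at the cut and resumes at the end of the block that is
    cut.\<close>
  define c' where "c' = case_nat a' (\<lambda>n. c (Suc (k + n)))"
  show ?case
  proof (rule oseg.seq[of c' b "\<lambda>n. h (k + n)"])
    show "strict_mono c'"
      unfolding strict_mono_Suc_iff
      using j k seq.hyps(1) by (auto simp: c'_def strict_mono_Suc_iff split: nat.split)
    show "c' n < b" for n
      using seq by (auto simp: c'_def split: nat.split)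
    show "\<exists>n. x < c' n" if "x < b" for x
    proof -
      obtain n where "x < c n" using seq.hyps(3)[OF \<open>x < b\<close>] by blast
      also have "c n \<le> c (Suc (k + n))"
        using seq.hyps(1) by (simp add: strict_mono_less_eq)
      also have "\<dots> = c' (Suc n)" by (simp add: c'_def)
      finally show ?thesis by blast
    qed
    show "oseg (h (k + n)) (c' n) (c' (Suc n))" for n
      using seq.IH[of k a'] \<open>c k \<le> a'\<close> j k seq.hyps(5) by (cases n) (auto simp: c'_def)
  qed (use seq in \<open>auto simp: c'_def\<close>)
qed

text \<open>For a successor exponent the blocks are translates of the interval for the previous
  power; for a limit exponent they lie between powers whose exponents run through a cofinal
  sequence.\<close>

lemma oseg_omega_pow: "oseg g 0 (omega_pow g)"
proof (induction g rule: less_induct)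
  case (less g)
  show ?case
  proof (cases g rule: omega1_cases)
    case 1
    then show ?thesis by (simp add: omega_pow_rec one_omega1_def oseg.osuc)
  next
    case (2 h)
    show ?thesis
    proof (rule oseg.seq[of "omult (omega_pow h)" _ "\<lambda>_. h"])
      show "strict_mono (omult (omega_pow h))" using omega_pow_pos by (rule strict_mono_omult)
      then show "omult (omega_pow h) n < omega_pow g" for n
        unfolding 2 less_omega_pow_osuc_iff by (metis lessI strict_monoD)
      show "\<exists>n. x < omult (omega_pow h) n" if "x < omega_pow g" for x
        using that unfolding 2 less_omega_pow_osuc_iff .
      show "oseg h (omult (omega_pow h) n) (omult (omega_pow h) (Suc n))" for n
        using oseg_shift[OF less[of h], of "omult (omega_pow h) n"] 2 by (simp add: plus_omega1_rec)
    qed (use 2 in auto)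
  next
    case 3
    then obtain s :: "nat \<Rightarrow> omega1"
      where s: "strict_mono s" "\<And>n. s n < g" "\<And>x. x < g \<Longrightarrow> \<exists>n. x < s n"
      using olimit_cofinal_sequence by blast
    let ?c = "case_nat 0 (\<lambda>n. omega_pow (s n))"
    have mono: "omega_pow (s n) < omega_pow (s (Suc n))" for n
      using s(1) by (simp add: omega_pow_less strict_mono_Suc_iff)
    show ?thesis
    proof (rule oseg.seq[of ?c _ s])
      show "strict_mono ?c"
        unfolding strict_mono_Suc_iff using mono by (auto simp: omega_pow_pos split: nat.split)
      show "?c n < omega_pow g" for n
        using s(2) by (auto simp: omega_pow_less omega_pow_pos split: nat.split)
      show "\<exists>n. x < ?c n" if "x < omega_pow g" for x
      proof -
        obtain y where "y < g" "x < omega_pow y"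
          using \<open>x < omega_pow g\<close> unfolding omega_pow_rec(3)[OF 3] less_osup_image_iff by blast
        moreover from this obtain n where "y < s n" using s(3) by blast
        ultimately have "x < omega_pow (s n)" using order.strict_trans[OF _ omega_pow_less] by blast
        then show ?thesis by (intro exI[of _ "Suc n"]) simp
      qed
      show "oseg (s n) (?c n) (?c (Suc n))" for n
        using less[OF s(2)] oseg_tail[OF less[OF s(2)]] mono by (cases n) auto
    qed (use s in auto)
  qed
qed


section \<open>Copies of trees inside Cantor--Bendixson derivatives\<close>

lemma cb_derivative_osuc_subset: "cb_derivative X (osuc a) \<subseteq> cb_derivative X a"
  by (auto simp: cb_derivative_rec nonisolated_def)

lemma cb_derivative_antimono: "a \<le> b \<Longrightarrow> cb_derivative X b \<subseteq> cb_derivative X a"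
proof (induction b rule: less_induct)
  case (less b)
  show ?case
  proof (cases "a = b")
    case False
    then have "a < b" using less.prems by simp
    show ?thesis
    proof (cases b rule: omega1_cases)
      case (2 c)
      then have "cb_derivative X c \<subseteq> cb_derivative X a"
        using less.IH[of c] \<open>a < b\<close> by (simp add: less_osuc_iff)
      then show ?thesis using cb_derivative_osuc_subset[of X c] 2 by blast
    next
      case 3
      then show ?thesis using \<open>a < b\<close> by (auto simp: cb_derivative_rec)
    qed (use \<open>a < b\<close> in auto)
  qed simp
qed

lemma cb_derivative_subset_topspace: "cb_derivative X a \<subseteq> topspace X"
  using cb_derivative_antimono[of 0 a X] by (simp add: cb_derivative_rec)

text \<open>By monotonicity x lies in the derivative of order \<open>osuc a\<close>, so it is not
  isolated in the one of order a.\<close>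

lemma cb_derivative_accumulate:
  assumes "x \<in> cb_derivative X b" "a < b" "openin X W" "x \<in> W"
  obtains y where "y \<in> cb_derivative X a" "y \<in> W" "y \<noteq> x"
proof -
  let ?D = "cb_derivative X a"
  have x: "x \<in> nonisolated (subtopology X ?D)"
    using assms(1) cb_derivative_antimono[of "osuc a" b X] \<open>a < b\<close>
    by (auto simp: cb_derivative_rec osuc_le_iff)
  then have "W \<inter> ?D \<noteq> {x}"
    using assms(3) by (auto simp: nonisolated_def openin_subtopology)
  moreover have "x \<in> W \<inter> ?D"
    using x assms(4) by (auto simp: nonisolated_def)
  ultimately show thesis using that by blast
qed

text \<open>Neighbourhoods V n of x shrink step by step, and each step splits off an open set U n
  disjoint from V (Suc n). Later sets lie inside later neighbourhoods, hence disjointness, and x is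
  avoided because it stays in every V n.\<close>

lemma cb_derivative_separated_family:
  fixes X :: "'a topology" and e :: "nat \<Rightarrow> omega1"
  assumes "Hausdorff_space X" "x \<in> cb_derivative X b" "openin X W" "x \<in> W"
    and e: "\<And>n. n \<in> I \<Longrightarrow> e n < b"
  obtains U where "\<And>n. n \<in> I \<Longrightarrow> openin X (U n)" "\<And>n. n \<in> I \<Longrightarrow> U n \<subseteq> W - {x}"
    "\<And>n. n \<in> I \<Longrightarrow> U n \<inter> cb_derivative X (e n) \<noteq> {}"
    "\<And>m n. m \<in> I \<Longrightarrow> n \<in> I \<Longrightarrow> m \<noteq> n \<Longrightarrow> U m \<inter> U n = {}"
proof -
  define P where "P V \<longleftrightarrow> openin X V \<and> x \<in> V \<and> V \<subseteq> W" for V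
  have step: "\<exists>V' U. P V' \<and> V' \<subseteq> V \<and> openin X U \<and> U \<subseteq> V - V' \<and>
      (n \<in> I \<longrightarrow> U \<inter> cb_derivative X (e n) \<noteq> {})" if V: "P V" for V n
  proof (cases "n \<in> I")
    case False
    then show ?thesis using V by (intro exI[of _ V] exI[of _ "{}"]) auto
  next
    case True
    obtain y where y: "y \<in> cb_derivative X (e n)" "y \<in> V" "y \<noteq> x"
      using cb_derivative_accumulate[OF assms(2) e[OF True]] V unfolding P_def by blast
    then obtain A B where AB: "openin X A" "openin X B" "x \<in> A" "y \<in> B" "disjnt A B"
      using assms(1) V cb_derivative_subset_topspace[of X] assms(2)
      unfolding Hausdorff_space_def by (metis subsetD)
    then show ?thesis
      using V y unfolding P_def disjnt_def
      by (intro exI[of _ "V \<inter> A"] exI[of _ "V \<inter> B"]) (auto intro: openin_Int)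
  qed
  have "P W" using assms by (simp add: P_def)
  obtain V where V: "P (V 0)"
    "\<And>n. P (V n) \<Longrightarrow> P (V (Suc n)) \<and> V (Suc n) \<subseteq> V n \<and> (\<exists>U. openin X U \<and> U \<subseteq> V n - V (Suc n) \<and>
      (n \<in> I \<longrightarrow> U \<inter> cb_derivative X (e n) \<noteq> {}))"
  proof -
    define V where "V = rec_nat W (\<lambda>n V. SOME V'. P V' \<and> V' \<subseteq> V \<and> (\<exists>U. openin X U \<and> U \<subseteq> V - V' \<and>
      (n \<in> I \<longrightarrow> U \<inter> cb_derivative X (e n) \<noteq> {})))"
    show thesis
    proof (rule that[of V])
      show "P (V 0)" using \<open>P W\<close> by (simp add: V_def)
      show "P (V (Suc n)) \<and> V (Suc n) \<subseteq> V n \<and> (\<exists>U. openin X U \<and> U \<subseteq> V n - V (Suc n) \<and>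
        (n \<in> I \<longrightarrow> U \<inter> cb_derivative X (e n) \<noteq> {}))" if "P (V n)" for n
        unfolding V_def nat.rec(2) unfolding V_def[symmetric]
        by (rule someI_ex) (use step[OF that, of n] in blast)
    qed
  qed
  have PV: "P (V n)" for n by (induction n) (use V in auto)
  obtain U where U: "\<And>n. openin X (U n)" "\<And>n. U n \<subseteq> V n - V (Suc n)"
    "\<And>n. n \<in> I \<Longrightarrow> U n \<inter> cb_derivative X (e n) \<noteq> {}"
    using V(2)[OF PV] by metis
  have anti: "V n \<subseteq> V m" if "m \<le> n" for m n
    using lift_Suc_antimono_le[of V] V(2)[OF PV] that by blast
  have disj: "U m \<inter> U n = {}" if "m < n" for m n
    using U(2)[of m] U(2)[of n] anti[of "Suc m" n] that by auto
  show thesis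
  proof (rule that[of U])
    show "U n \<subseteq> W - {x}" for n
      using U(2)[of n] PV[of n] PV[of "Suc n"] unfolding P_def by blast
    show "U m \<inter> U n = {}" if "m \<noteq> n" for m n
      using that disj[of m n] disj[of n m] by (metis inf_commute linorder_neqE_nat)
  qed (use U in auto)
qed

text \<open>A Urysohn function is guaranteed to be 1 only at x; doubling and truncating it gives 1
  on a whole neighbourhood, in which subtrees can be placed.\<close>

lemma bump_function:
  assumes "compact_space X" "Hausdorff_space X" "openin X U" "x \<in> U"
  obtains \<phi> V where "continuous_map X euclideanreal \<phi>" "openin X V" "x \<in> V" "V \<subseteq> U"
    "\<And>y. 0 \<le> \<phi> y" "\<And>y. \<phi> y \<le> 1" "\<And>y. y \<in> V \<Longrightarrow> \<phi> y = 1" "\<And>y. y \<notin> U \<Longrightarrow> \<phi> y = 0"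
proof -
  have xt: "x \<in> topspace X" using assms openin_subset by blast
  have "normal_space X"
    using assms compact_Hausdorff_or_regular_imp_normal_space by blast
  moreover have "closedin X {x}"
    using assms(2) xt by (simp add: closedin_Hausdorff_singleton)
  moreover have "closedin X (topspace X - U)" using assms(3) by blast
  ultimately obtain f where f: "continuous_map X (top_of_set {0..1::real}) f"
    "f ` (topspace X - U) \<subseteq> {0}" "f ` {x} \<subseteq> {1}"
    using Urysohn_lemma[of X "topspace X - U" "{x}" 0 1] assms(4) by (auto simp: disjnt_def)
  have fc: "continuous_map X euclideanreal f" and f01: "\<And>y. y \<in> topspace X \<Longrightarrow> 0 \<le> f y \<and> f y \<le> 1"
    using f(1) by (auto simp: continuous_map_in_subtopology)
  \<comment> \<open>The value 0 off the space makes the bounds and the support condition hold for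
    every y.\<close>
  define \<phi> where "\<phi> y = (if y \<in> topspace X then min 1 (2 * f y) else 0)" for y
  show thesis
  proof (rule that[of \<phi> "{y \<in> topspace X. f y \<in> {1/2<..}}"])
    have "continuous_map X euclideanreal (\<lambda>y. min 1 (2 * f y))"
      by (intro continuous_intros fc) simp
    then show "continuous_map X euclideanreal \<phi>"
      by (rule continuous_map_eq) (simp add: \<phi>_def)
    show "openin X {y \<in> topspace X. f y \<in> {1/2<..}}"
      by (rule openin_continuous_map_preimage[OF fc]) (simp add: open_openin[symmetric])
    show "{y \<in> topspace X. f y \<in> {1/2<..}} \<subseteq> U" using f(2) by force
  qed (use f f01 xt openin_subset[OF assms(3)] in \<open>force simp: \<phi>_def\<close>)+
qed

section \<open>Averaging operators supported in open sets\<close>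

text \<open>A copy of the function space \<open>N\<close> on the set \<open>S\<close> inside the functions supported in the
  open set \<open>U\<close>; the bound says that \<open>T f y\<close> is an average of \<open>f\<close>, scaled by \<open>T 1 y\<close>.\<close>

definition sub_copy ::
  "'a topology \<Rightarrow> 'a set \<Rightarrow> 'b set \<Rightarrow> ('b \<Rightarrow> real) set \<Rightarrow> (('b \<Rightarrow> real) \<Rightarrow> 'a \<Rightarrow> real) \<Rightarrow> bool" where
  "sub_copy K U S N T \<longleftrightarrow>
     (\<forall>f g c d. T (\<lambda>x. c * f x + d * g x) = (\<lambda>y. c * T f y + d * T g y)) \<and>
     (\<forall>f y. y \<notin> U \<longrightarrow> T f y = 0) \<and>
     (\<forall>y. T (\<lambda>_. 1) y \<le> 1) \<and>
     (\<forall>f M y. (\<forall>x\<in>S. \<bar>f x\<bar> \<le> M) \<longrightarrow> \<bar>T f y\<bar> \<le> M * T (\<lambda>_. 1) y) \<and>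
     (\<forall>f\<in>N. continuous_map K euclideanreal (T f)) \<and>
     (\<forall>s\<in>S. \<exists>y\<in>U. \<forall>f. T f y = f s)"

text \<open>Demanded for every open set meeting the derivative, because the recursion puts the
  pieces into prescribed disjoint open sets.\<close>

definition embeds_at_rank :: "'a topology \<Rightarrow> omega1 \<Rightarrow> 'b set \<Rightarrow> ('b \<Rightarrow> real) set \<Rightarrow> bool" where
  "embeds_at_rank K a S N \<longleftrightarrow>
     (\<forall>U. openin K U \<longrightarrow> U \<inter> cb_derivative K a \<noteq> {} \<longrightarrow> (\<exists>T. sub_copy K U S N T))"

lemma sub_copyD:
  assumes "sub_copy K U S N T"
  shows "T (\<lambda>x. c * f x + d * g x) y = c * T f y + d * T g y"
    and "y \<notin> U \<Longrightarrow> T f y = 0"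
    and "T (\<lambda>_. 1) y \<le> 1"
    and "(\<And>x. x \<in> S \<Longrightarrow> \<bar>f x\<bar> \<le> M) \<Longrightarrow> \<bar>T f y\<bar> \<le> M * T (\<lambda>_. 1) y"
    and "f \<in> N \<Longrightarrow> continuous_map K euclideanreal (T f)"
    and "s \<in> S \<Longrightarrow> \<exists>y\<in>U. \<forall>f. T f y = f s"
  using assms unfolding sub_copy_def by simp_all

lemma sub_copy_diff_const:
  "sub_copy K U S N T \<Longrightarrow> T (\<lambda>x. f x - c) y = T f y - c * T (\<lambda>_. 1) y"
  using sub_copyD(1)[of K U S N T 1 f "- c" "\<lambda>_. 1" y] by simp

text \<open>To \<open>f p\<close> times a bump the operator adds the operators of the pieces,
  applied to the increments \<open>f (\<rho> n x) - f p\<close>. These tend to 0 uniformly, so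
  continuity survives the infinite sum. The maps \<open>\<rho> n\<close> may identify points, which
  allows collapsing.\<close>

lemma embeds_at_rank_step:
  fixes K :: "'a topology" and S :: "'b set" and I :: "nat set"
  assumes K: "compact_space K" "Hausdorff_space K"
    and e: "\<And>n. n \<in> I \<Longrightarrow> e n < a" "\<And>n. n \<in> I \<Longrightarrow> embeds_at_rank K (e n) (S' n) (N' n)"
    and S: "p \<in> S" "S \<subseteq> insert p (\<Union>n\<in>I. \<rho> n ` S' n)" "\<And>n. n \<in> I \<Longrightarrow> \<rho> n ` S' n \<subseteq> S"
    and N: "\<And>n f. n \<in> I \<Longrightarrow> f \<in> N \<Longrightarrow> (\<lambda>x. f (\<rho> n x) - f p) \<in> N' n"
    and conv: "\<And>f \<epsilon>. f \<in> N \<Longrightarrow> 0 < \<epsilon> \<Longrightarrow> finite {n \<in> I. \<exists>x\<in>S' n. \<epsilon> < \<bar>f (\<rho> n x) - f p\<bar>}"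
  shows "embeds_at_rank K a S N"
  unfolding embeds_at_rank_def
proof (intro allI impI)
  fix W assume W: "openin K W" "W \<inter> cb_derivative K a \<noteq> {}"
  then obtain x0 where x0: "x0 \<in> W" "x0 \<in> cb_derivative K a" by blast
  obtain \<phi> V where \<phi>: "continuous_map K euclideanreal \<phi>" "openin K V" "x0 \<in> V" "V \<subseteq> W"
    "\<And>y. 0 \<le> \<phi> y" "\<And>y. \<phi> y \<le> 1" "\<And>y. y \<in> V \<Longrightarrow> \<phi> y = 1" "\<And>y. y \<notin> W \<Longrightarrow> \<phi> y = 0"
    using bump_function[OF K W(1) x0(1)] by blast
  obtain U where U: "\<And>n. n \<in> I \<Longrightarrow> openin K (U n)" "\<And>n. n \<in> I \<Longrightarrow> U n \<subseteq> V - {x0}"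
    "\<And>n. n \<in> I \<Longrightarrow> U n \<inter> cb_derivative K (e n) \<noteq> {}"
    "\<And>m n. m \<in> I \<Longrightarrow> n \<in> I \<Longrightarrow> m \<noteq> n \<Longrightarrow> U m \<inter> U n = {}"
    using cb_derivative_separated_family[OF K(2) x0(2) \<phi>(2,3), of I e] e(1) by blast
  have "\<exists>T. sub_copy K (U n) (S' n) (N' n) T" if "n \<in> I" for n
    using e(2)[OF that] U[OF that] unfolding embeds_at_rank_def by blast
  then obtain T' where T': "\<And>n. n \<in> I \<Longrightarrow> sub_copy K (U n) (S' n) (N' n) (T' n)" by metis
  define R where "R n f = T' n (\<lambda>x. f (\<rho> n x) - f p)" for n and f :: "'b \<Rightarrow> real"
  \<comment> \<open>The sets U n are disjoint, so at most one piece contributes at y and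
    \<open>THE\<close> picks it.\<close>
  define T where "T f y = f p * \<phi> y +
      (if \<exists>n\<in>I. y \<in> U n then R (THE n. n \<in> I \<and> y \<in> U n) f y else 0)" for f y
  have T_in: "T f y = f p * \<phi> y + R n f y" if "n \<in> I" "y \<in> U n" for f n y
  proof -
    have "(THE n. n \<in> I \<and> y \<in> U n) = n"
      by (rule the_equality) (use that U(4) in blast)+
    then show ?thesis using that by (auto simp: T_def)
  qed
  have T_out: "T f y = f p * \<phi> y" if "\<And>n. n \<in> I \<Longrightarrow> y \<notin> U n" for f y
    using that by (auto simp: T_def)
  have R: "R n f y = T' n (\<lambda>x. f (\<rho> n x)) y - f p * T' n (\<lambda>_. 1) y" if "n \<in> I" for n f y
    unfolding R_def by (rule sub_copy_diff_const[OF T'[OF that]])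
  have R_zero: "R n f y = 0" if "n \<in> I" "y \<notin> U n" for n f y
    unfolding R_def by (rule sub_copyD(2)[OF T'[OF that(1)] that(2)])
  have T_one: "T (\<lambda>_. 1) y = \<phi> y" for y
  proof (cases "\<exists>n\<in>I. y \<in> U n")
    case True
    then obtain n where n: "n \<in> I" "y \<in> U n" by blast
    show ?thesis using R[OF n(1), of "\<lambda>_. 1" y] by (simp add: T_in[OF n])
  qed (simp add: T_out)
  have T'01: "0 \<le> T' n (\<lambda>_. 1) y" "T' n (\<lambda>_. 1) y \<le> 1" if "n \<in> I" for n y
  proof -
    have "\<bar>T' n (\<lambda>_. 1) y\<bar> \<le> 1 * T' n (\<lambda>_. 1) y"
      by (rule sub_copyD(4)[OF T'[OF that]]) simp
    then show "0 \<le> T' n (\<lambda>_. 1) y" by simp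
    show "T' n (\<lambda>_. 1) y \<le> 1" by (rule sub_copyD(3)[OF T'[OF that]])
  qed
  have "sub_copy K W S N T"
    unfolding sub_copy_def
  proof (intro conjI allI ballI impI)
    show "T (\<lambda>x. c * f x + d * g x) = (\<lambda>y. c * T f y + d * T g y)" for f g c d
    proof
      fix y
      show "T (\<lambda>x. c * f x + d * g x) y = c * T f y + d * T g y"
      proof (cases "\<exists>n\<in>I. y \<in> U n")
        case True
        then obtain n where n: "n \<in> I" "y \<in> U n" by blast
        show ?thesis
          unfolding T_in[OF n] R[OF n(1)] sub_copyD(1)[OF T'[OF n(1)]] by (simp add: algebra_simps)
      next
        case False
        then show ?thesis by (simp add: T_out algebra_simps)
      qed
    qed
    show "T f y = 0" if "y \<notin> W" for f y
    proof -
      have "y \<notin> U n" if "n \<in> I" for n using U(2)[OF that] \<phi>(4) \<open>y \<notin> W\<close> by blast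
      then show ?thesis using \<phi>(8)[OF that] by (simp add: T_out)
    qed
    show "T (\<lambda>_. 1) y \<le> 1" for y by (simp add: T_one \<phi>)
    show "\<bar>T f y\<bar> \<le> M * T (\<lambda>_. 1) y" if M: "\<forall>x\<in>S. \<bar>f x\<bar> \<le> M" for f M y
    proof (cases "\<exists>n\<in>I. y \<in> U n")
      case True
      then obtain n where n: "n \<in> I" "y \<in> U n" by blast
      then have \<phi>1: "\<phi> y = 1" using \<phi>(7) U(2) by blast
      \<comment> \<open>The bump is 1 on U n, so the value there combines \<open>f p\<close> and the
        value of the piece operator on f, with weights 1 - t and t for the bounds.\<close>
      let ?t = "T' n (\<lambda>_. 1) y"
      have "\<bar>T' n (\<lambda>x. f (\<rho> n x)) y\<bar> \<le> M * ?t"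
        by (rule sub_copyD(4)[OF T'[OF n(1)]]) (use M S(3)[OF n(1)] in blast)
      moreover have "\<bar>f p * (1 - ?t)\<bar> \<le> M * (1 - ?t)"
        using M S(1) T'01[OF n(1)] by (simp add: abs_mult mult_right_mono)
      moreover have "T f y = f p * (1 - ?t) + T' n (\<lambda>x. f (\<rho> n x)) y"
        by (simp add: T_in[OF n] R[OF n(1)] \<phi>1 algebra_simps)
      ultimately have "\<bar>T f y\<bar> \<le> M * (1 - ?t) + M * ?t" by linarith
      then show ?thesis by (simp add: T_one \<phi>1 algebra_simps)
    next
      case False
      then show ?thesis using M S(1) \<phi>(5)[of y]
        by (simp add: T_one T_out abs_mult mult_right_mono)
    qed
    show "\<exists>y\<in>W. \<forall>f. T f y = f s" if "s \<in> S" for s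
    proof (cases "s = p")
      case True
      have "x0 \<notin> U n" if "n \<in> I" for n using U(2)[OF that] by blast
      then show ?thesis using True x0 \<phi>(3,7) by (intro bexI[of _ x0]) (simp_all add: T_out)
    next
      case False
      then obtain n s' where s': "n \<in> I" "s' \<in> S' n" "s = \<rho> n s'" using S(2) \<open>s \<in> S\<close> by blast
      then obtain y where y: "y \<in> U n" "\<And>f. T' n f y = f s'"
        using T'[OF s'(1)] unfolding sub_copy_def by blast
      have "y \<in> V" using U(2)[OF s'(1)] y(1) by blast
      then have "y \<in> W" "\<phi> y = 1" using \<phi>(4,7) by blast+
      then show ?thesis
        using y(2) s' by (intro bexI[of _ y]) (simp_all add: T_in[OF s'(1) y(1)] R_def)
    qed
    show "continuous_map K euclideanreal (T f)" if f: "f \<in> N" for f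
    proof -
      \<comment> \<open>Partial sums over the pieces with index below k; T f is their uniform
        limit.\<close>
      define F where "F k y = f p * \<phi> y + (\<Sum>n\<in>{n\<in>I. n < k}. R n f y)" for k :: nat and y
      have Fc: "continuous_map K euclideanreal (F k)" for k
      proof -
        have "continuous_map K euclideanreal (R n f)" if "n \<in> I" for n
          using T'[OF that] N[OF that f] unfolding R_def sub_copy_def by blast
        then have "continuous_map K euclideanreal (\<lambda>y. f p * \<phi> y + (\<Sum>n\<in>{n\<in>I. n < k}. R n f y))"
          by (intro continuous_intros \<phi>(1)) auto
        then show ?thesis by (simp add: F_def[abs_def])
      qed
      have "continuous_map K Met_TC.mtopology (T f)"
      proof (rule Met_TC.continuous_map_uniform_limit[where f = F and F = sequentially])
        show "\<forall>\<^sub>F k in sequentially. continuous_map K Met_TC.mtopology (F k)"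
          using Fc by simp
        fix \<epsilon> :: real assume "0 < \<epsilon>"
        then have "finite {n \<in> I. \<exists>x\<in>S' n. \<epsilon>/2 < \<bar>f (\<rho> n x) - f p\<bar>}" by (intro conv[OF f]) simp
        then obtain k0 where k0: "\<And>n. n \<in> I \<Longrightarrow> k0 \<le> n \<Longrightarrow> \<forall>x\<in>S' n. \<bar>f (\<rho> n x) - f p\<bar> \<le> \<epsilon>/2"
          unfolding finite_nat_set_iff_bounded by (metis (mono_tags, lifting) leD mem_Collect_eq not_le)
        have close: "\<bar>F k y - T f y\<bar> < \<epsilon>" if "k0 \<le> k" for k y
        proof (cases "\<exists>n\<in>I. y \<in> U n")
          case True
          then obtain n where n: "n \<in> I" "y \<in> U n" by blast
          have "(\<Sum>m\<in>{m\<in>I. m < k}. R m f y) = (\<Sum>m\<in>{m\<in>I. m < k}. if m = n then R n f y else 0)"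
          proof (rule sum.cong[OF refl])
            fix m assume "m \<in> {m\<in>I. m < k}"
            then show "R m f y = (if m = n then R n f y else 0)"
              using U(4)[of m n] n R_zero[of m y f] by auto
          qed
          also have "\<dots> = (if n < k then R n f y else 0)" using n by simp
          finally have eq: "F k y - T f y = (if n < k then 0 else - R n f y)"
            by (simp add: F_def T_in[OF n])
          show ?thesis
          proof (cases "n < k")
            case False
            have "\<bar>R n f y\<bar> \<le> \<epsilon>/2 * T' n (\<lambda>_. 1) y"
              unfolding R_def by (rule sub_copyD(4)[OF T'[OF n(1)]]) (use k0[OF n(1)] False that in auto)
            also have "\<dots> \<le> \<epsilon>/2" using T'01[OF n(1)] \<open>0 < \<epsilon>\<close> by simp
            finally show ?thesis using eq False \<open>0 < \<epsilon>\<close> by simp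
          qed (use eq \<open>0 < \<epsilon>\<close> in simp)
        next
          case False
          then have "(\<Sum>m\<in>{m\<in>I. m < k}. R m f y) = 0" by (intro sum.neutral) (use R_zero in auto)
          then show ?thesis using False \<open>0 < \<epsilon>\<close> by (simp add: F_def T_out)
        qed
        show "\<forall>\<^sub>F k in sequentially. \<forall>y\<in>topspace K. T f y \<in> UNIV \<and> dist (F k y) (T f y) < \<epsilon>"
          unfolding eventually_sequentially dist_real_def using close by blast
      qed simp
      then show ?thesis by simp
    qed
  qed
  then show "\<exists>T. sub_copy K W S N T" by blast
qed

section \<open>Trees with convergent subtrees\<close>

text \<open>\<open>ranked_tree g X N\<close>: \<open>X\<close> is the vertex set of a well-founded tree of rank at most \<open>g\<close> in
  which the subtrees of a node are taken to converge to that node, and \<open>N\<close> consists of the functions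
  continuous for the resulting compact topology.\<close>

inductive ranked_tree :: "omega1 \<Rightarrow> 'b set \<Rightarrow> ('b \<Rightarrow> real) set \<Rightarrow> bool" where
  node: "(\<And>n::nat. n \<in> I \<Longrightarrow> h n < g) \<Longrightarrow> (\<And>n. n \<in> I \<Longrightarrow> ranked_tree (h n) (Y n) (M n)) \<Longrightarrow>
    (\<And>n. n \<in> I \<Longrightarrow> p \<notin> Y n) \<Longrightarrow>
    (\<And>m n. m \<in> I \<Longrightarrow> n \<in> I \<Longrightarrow> m \<noteq> n \<Longrightarrow> Y m \<inter> Y n = {}) \<Longrightarrow>
    X = insert p (\<Union>n\<in>I. Y n) \<Longrightarrow>
    N = {f. (\<forall>n\<in>I. f \<in> M n) \<and> (\<forall>\<epsilon>>0. finite {n \<in> I. \<exists>x\<in>Y n. \<epsilon> < \<bar>f x - f p\<bar>})} \<Longrightarrow>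
    ranked_tree g X N"

lemma ranked_tree_leaf: "ranked_tree g {p} UNIV"
  by (rule ranked_tree.node[where I = "{}"]) simp_all

lemma ranked_tree_const: "ranked_tree g X N \<Longrightarrow> (\<lambda>_. c) \<in> N"
  by (induction rule: ranked_tree.induct) auto

text \<open>f' is prescribed on X only: with c = 1 and d = 0 this says that membership in N depends
  on the values on X alone.\<close>

lemma ranked_tree_affine:
  "ranked_tree g X N \<Longrightarrow> f \<in> N \<Longrightarrow> (\<And>x. x \<in> X \<Longrightarrow> f' x = c * f x + d) \<Longrightarrow> f' \<in> N"
proof (induction arbitrary: f f' rule: ranked_tree.induct)
  case (node I h g Y M p X N)
  have "finite {n \<in> I. \<exists>x\<in>Y n. \<epsilon> < \<bar>f' x - f' p\<bar>}" if "0 < \<epsilon>" for \<epsilon>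
  proof -
    have "f' x - f' p = c * (f x - f p)" if "n \<in> I" "x \<in> Y n" for n x
      using that node.prems(2)[of x] node.prems(2)[of p] node.hyps(5) by (auto simp: algebra_simps)
    \<comment> \<open>The divisor |c| + 1 exceeds |c| and is positive also for c = 0.\<close>
    moreover have "\<epsilon> / (\<bar>c\<bar> + 1) < \<bar>z\<bar>" if "\<epsilon> < \<bar>c * z\<bar>" for z
    proof -
      have "\<epsilon> < (\<bar>c\<bar> + 1) * \<bar>z\<bar>" using that by (simp add: abs_mult algebra_simps)
      then show ?thesis by (simp add: pos_divide_less_eq mult.commute)
    qed
    ultimately have "{n \<in> I. \<exists>x\<in>Y n. \<epsilon> < \<bar>f' x - f' p\<bar>} \<subseteq>
        {n \<in> I. \<exists>x\<in>Y n. \<epsilon> / (\<bar>c\<bar> + 1) < \<bar>f x - f p\<bar>}" by fastforce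
    moreover have "finite {n \<in> I. \<exists>x\<in>Y n. \<epsilon> / (\<bar>c\<bar> + 1) < \<bar>f x - f p\<bar>}"
      using node.prems(1) node.hyps(6) \<open>0 < \<epsilon>\<close> by simp
    ultimately show ?thesis using finite_subset by blast
  qed
  moreover have "f' \<in> M n" if "n \<in> I" for n
    using node.IH[OF that, of f f'] node.prems node.hyps(5,6) that by blast
  ultimately show ?case using node.hyps(6) by blast
qed

text \<open>Relabelling can make overlapping trees disjoint: the blocks of a
  \<open>block_system\<close> are tagged by their index in this way.\<close>

lemma ranked_tree_image:
  "ranked_tree g X N \<Longrightarrow> inj \<sigma> \<Longrightarrow> ranked_tree g (\<sigma> ` X) {f. f \<circ> \<sigma> \<in> N}"
proof (induction rule: ranked_tree.induct)
  case (node I h g Y M p X N)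
  show ?case
  proof (rule ranked_tree.node[where I = I and h = h and Y = "\<lambda>n. \<sigma> ` Y n" and
        M = "\<lambda>n. {f. f \<circ> \<sigma> \<in> M n}" and p = "\<sigma> p"])
    show "\<sigma> ` Y m \<inter> \<sigma> ` Y n = {}" if "m \<in> I" "n \<in> I" "m \<noteq> n" for m n
      using node.hyps(4)[OF that] node.prems by (simp flip: image_Int)
  qed (use node in \<open>auto simp: inj_image_mem_iff o_def\<close>)
qed

section \<open>Collapsing subtrees, and products of two trees\<close>

definition collapse :: "nat set \<Rightarrow> (nat \<Rightarrow> 'b set) \<Rightarrow> 'b \<Rightarrow> nat \<Rightarrow> 'b \<Rightarrow> 'b" where
  "collapse I Y p n x = (if \<exists>i\<in>I. i < n \<and> x \<in> Y i then p else x)"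

text \<open>On a single subtree the composite is either constantly \<open>f p\<close> or f itself,
  since the subtrees are disjoint; increments from the root become 0 or stay.\<close>

lemma ranked_tree_collapse:
  assumes tree: "\<And>n. n \<in> I \<Longrightarrow> ranked_tree (h n) (Y n) (M n)"
    and disj: "\<And>m n. m \<in> I \<Longrightarrow> n \<in> I \<Longrightarrow> m \<noteq> n \<Longrightarrow> Y m \<inter> Y n = {}"
    and f: "\<And>i. i \<in> I \<Longrightarrow> f \<in> M i" "\<And>\<epsilon>. 0 < \<epsilon> \<Longrightarrow> finite {i \<in> I. \<exists>x\<in>Y i. \<epsilon> < \<bar>f x - f p\<bar>}"
  shows "\<And>i. i \<in> I \<Longrightarrow> f \<circ> collapse I Y p n \<in> M i"
    "\<And>\<epsilon>. 0 < \<epsilon> \<Longrightarrow> finite {i \<in> I. \<exists>x\<in>Y i. \<epsilon> < \<bar>(f \<circ> collapse I Y p n) x - (f \<circ> collapse I Y p n) p\<bar>}"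
proof -
  fix i assume i: "i \<in> I"
  show "f \<circ> collapse I Y p n \<in> M i"
  proof (cases "i < n")
    case True
    then show ?thesis
      using i by (intro ranked_tree_affine[OF tree[OF i] ranked_tree_const[OF tree[OF i], of 0], where c = 0 and d = "f p"])
        (auto simp: collapse_def)
  next
    case False
    then have "collapse I Y p n x = x" if "x \<in> Y i" for x
      using disj[OF i] that unfolding collapse_def by (metis IntI empty_iff)
    then show ?thesis
      by (intro ranked_tree_affine[OF tree[OF i] f(1)[OF i], where c = 1 and d = 0]) simp
  qed
next
  fix \<epsilon> :: real assume "0 < \<epsilon>"
  have p: "collapse I Y p n p = p" by (simp add: collapse_def)
  have "{i \<in> I. \<exists>x\<in>Y i. \<epsilon> < \<bar>(f \<circ> collapse I Y p n) x - (f \<circ> collapse I Y p n) p\<bar>}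
      \<subseteq> {i \<in> I. \<exists>x\<in>Y i. \<epsilon> < \<bar>f x - f p\<bar>}"
    using \<open>0 < \<epsilon>\<close> by (auto simp: p) (auto simp: collapse_def split: if_splits)
  then show "finite {i \<in> I. \<exists>x\<in>Y i. \<epsilon> < \<bar>(f \<circ> collapse I Y p n) x - (f \<circ> collapse I Y p n) p\<bar>}"
    using f(2)[OF \<open>0 < \<epsilon>\<close>] finite_subset by blast
qed

text \<open>Once n passes the indices of the finitely many subtrees with a large increment, all of
  them are sent to the root.\<close>

lemma collapse_bound:
  assumes "finite {i \<in> I. \<exists>x\<in>Y i. \<epsilon> < \<bar>f x - f p :: real\<bar>}" "0 < \<epsilon>"
  shows "\<exists>n0. \<forall>n\<ge>n0. \<forall>x \<in> insert p (\<Union>i\<in>I. Y i). \<bar>f (collapse I Y p n x) - f p\<bar> \<le> \<epsilon>"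
proof -
  obtain n0 where n0: "\<And>i. i \<in> I \<Longrightarrow> (\<exists>x\<in>Y i. \<epsilon> < \<bar>f x - f p\<bar>) \<Longrightarrow> i < n0"
    using assms(1) unfolding finite_nat_set_iff_bounded by blast
  have "\<bar>f (collapse I Y p n x) - f p\<bar> \<le> \<epsilon>"
    if "n0 \<le> n" "x \<in> insert p (\<Union>i\<in>I. Y i)" for n x
    using that n0[of _] \<open>0 < \<epsilon>\<close> unfolding collapse_def
    by (smt (verit, best) UN_E insert_iff linorder_not_le order.strict_trans2)
  then show ?thesis by blast
qed

text \<open>The class contains the averages of \<open>f s\<close> and \<open>f t\<close>, and
  increments on a block of the product again have this form.\<close>

definition pair_sums :: "('b \<Rightarrow> real) set \<Rightarrow> ('c \<Rightarrow> real) set \<Rightarrow> ('b \<times> 'c \<Rightarrow> real) set" where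
  "pair_sums N M = {\<lambda>z. f (fst z) + g (snd z) | f g. f \<in> N \<and> g \<in> M}"

text \<open>The block of \<open>X \<times> Y\<close> belonging to the \<open>i\<close>-th subtree of \<open>X\<close> is its product with \<open>Y\<close>, in which the
  first \<open>i\<close> subtrees are collapsed to the root so that the blocks converge to the pair of roots.\<close>

theorem ranked_tree_prod_embeds:
  fixes X :: "'b set" and Y :: "'c set"
  assumes K: "compact_space K" "Hausdorff_space K"
  shows "ranked_tree g X N \<Longrightarrow> ranked_tree g' Y M \<Longrightarrow> nsum g g' a \<Longrightarrow>
    embeds_at_rank K a (X \<times> Y) (pair_sums N M)"
proof (induction arbitrary: g' Y M a rule: ranked_tree.induct)
  case outer: (node I h g X\<^sub>i N\<^sub>i p X N)
  have X: "ranked_tree g X N" by (rule ranked_tree.node) (use outer in auto)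
  from outer.prems show ?case
  \<comment> \<open>A subtree of X is paired with all of Y by the outer hypothesis, a subtree of Y
    with all of X by the inner one; \<open>nsum\<close> yields a smaller rank either way.\<close>
  proof (induction arbitrary: a rule: ranked_tree.induct)
    case inner: (node J h' g' Y\<^sub>j M\<^sub>j q Y M)
    have Y: "ranked_tree g' Y M" by (rule ranked_tree.node) (use inner in auto)
    define rX where "rX = collapse I X\<^sub>i p"
    define rY where "rY = collapse J Y\<^sub>j q"
    have rp: "rX n p = p" "rY n q = q" for n by (simp_all add: rX_def rY_def collapse_def)
    have rX_in: "rX n ` X \<subseteq> X" and rY_in: "rY n ` Y \<subseteq> Y" for n
      unfolding rX_def rY_def collapse_def outer.hyps(5) inner.hyps(5) by auto
    have rX_id: "rX n x = x" if "i \<in> I" "x \<in> X\<^sub>i i" "n \<le> i" for n i x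
      using outer.hyps(4)[OF that(1)] that unfolding rX_def collapse_def by (metis IntI empty_iff not_less)
    have rY_id: "rY n y = y" if "j \<in> J" "y \<in> Y\<^sub>j j" "n \<le> j" for n j y
      using inner.hyps(4)[OF that(1)] that unfolding rY_def collapse_def by (metis IntI empty_iff not_less)
    have N: "f \<in> N \<Longrightarrow> i \<in> I \<Longrightarrow> f \<in> N\<^sub>i i" "f \<in> N \<Longrightarrow> f \<circ> rX n \<in> N"
      "f \<in> N \<Longrightarrow> 0 < \<epsilon> \<Longrightarrow> finite {i \<in> I. \<exists>x\<in>X\<^sub>i i. \<epsilon> < \<bar>f x - f p\<bar>}" for f i n \<epsilon>
      unfolding outer.hyps(6) rX_def using outer.hyps(2,4)
        ranked_tree_collapse(1)[where I = I and h = h and Y = X\<^sub>i and M = N\<^sub>i and f = f and p = p and n = n]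
        ranked_tree_collapse(2)[where I = I and h = h and Y = X\<^sub>i and M = N\<^sub>i and f = f and p = p and n = n]
      by auto
    have M: "f \<in> M \<Longrightarrow> j \<in> J \<Longrightarrow> f \<in> M\<^sub>j j" "f \<in> M \<Longrightarrow> f \<circ> rY n \<in> M"
      "f \<in> M \<Longrightarrow> 0 < \<epsilon> \<Longrightarrow> finite {j \<in> J. \<exists>y\<in>Y\<^sub>j j. \<epsilon> < \<bar>f y - f q\<bar>}" for f j n \<epsilon>
      unfolding inner.hyps(6) rY_def using inner.hyps(2,4)
        ranked_tree_collapse(1)[where I = J and h = h' and Y = Y\<^sub>j and M = M\<^sub>j and f = f and p = q and n = n]
        ranked_tree_collapse(2)[where I = J and h = h' and Y = Y\<^sub>j and M = M\<^sub>j and f = f and p = q and n = n]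
      by auto
    obtain a\<^sub>1 where a1: "\<And>i. i \<in> I \<Longrightarrow> a\<^sub>1 i < a" "\<And>i. i \<in> I \<Longrightarrow> nsum (h i) g' (a\<^sub>1 i)"
      using bchoice[of I "\<lambda>i c. c < a \<and> nsum (h i) g' c"] nsum_less_left[OF inner.prems] outer.hyps(1) by blast
    obtain a\<^sub>2 where a2: "\<And>j. j \<in> J \<Longrightarrow> a\<^sub>2 j < a" "\<And>j. j \<in> J \<Longrightarrow> nsum g (h' j) (a\<^sub>2 j)"
      using bchoice[of J "\<lambda>j c. c < a \<and> nsum g (h' j) c"] nsum_less_right[OF inner.prems] inner.hyps(1) by blast
    \<comment> \<open>Even indices stand for subtrees of X, odd ones for subtrees of Y.\<close>
    define E where "E = (\<lambda>n. 2 * n) ` I \<union> (\<lambda>n. 2 * n + 1) ` J"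
    define e where "e n = (if even n then a\<^sub>1 (n div 2) else a\<^sub>2 (n div 2))" for n :: nat
    define S where "S n = (if even n then X\<^sub>i (n div 2) \<times> Y else X \<times> Y\<^sub>j (n div 2))" for n
    define L where "L n = (if even n then pair_sums (N\<^sub>i (n div 2)) M else pair_sums N (M\<^sub>j (n div 2)))" for n
    define \<rho> where "\<rho> n z = (if even n then (fst z, rY (n div 2) (snd z)) else (rX (n div 2) (fst z), snd z))"
      for n and z :: "'b \<times> 'c"
    have EI: "even n \<and> n div 2 \<in> I \<or> odd n \<and> n div 2 \<in> J" if "n \<in> E" for n
      using that unfolding E_def by auto
    show ?case
    proof (rule embeds_at_rank_step[OF K, where I = E and e = e and S' = S and N' = L and p = "(p, q)" and \<rho> = \<rho>])
      fix n assume n: "n \<in> E"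
      show "e n < a" using EI[OF n] a1 a2 by (auto simp: e_def)
      show "embeds_at_rank K (e n) (S n) (L n)"
        using EI[OF n] outer.IH[OF _ Y a1(2)] inner.IH[OF _ a2(2)] by (auto simp: e_def S_def L_def)
      show "\<rho> n ` S n \<subseteq> X \<times> Y"
      proof (cases "even n")
        case True
        then have "X\<^sub>i (n div 2) \<subseteq> X" using EI[OF n] outer.hyps(5) by blast
        then show ?thesis using True rY_in[of "n div 2"] by (auto simp: S_def \<rho>_def)
      next
        case False
        then have "Y\<^sub>j (n div 2) \<subseteq> Y" using EI[OF n] inner.hyps(5) by blast
        then show ?thesis using False rX_in[of "n div 2"] by (auto simp: S_def \<rho>_def)
      qed
      fix F assume "F \<in> pair_sums N M"
      then obtain f g where F: "F = (\<lambda>z. f (fst z) + g (snd z))" "f \<in> N" "g \<in> M"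
        unfolding pair_sums_def by blast
      show "(\<lambda>z. F (\<rho> n z) - F (p, q)) \<in> L n"
      proof (cases "even n")
        case True
        then have n: "n div 2 \<in> I" using EI[OF n] by blast
        \<comment> \<open>The constant goes into one summand, so that the increment is again a sum
          of two one-variable functions.\<close>
        let ?g = "\<lambda>y. (g \<circ> rY (n div 2)) y - (f p + g q)"
        have "?g \<in> M"
          by (rule ranked_tree_affine[OF Y M(2)[OF F(3)], where c = 1 and d = "- (f p + g q)"]) simp
        moreover have "f \<in> N\<^sub>i (n div 2)" using N(1) F n by blast
        moreover have "(\<lambda>z. F (\<rho> n z) - F (p, q)) = (\<lambda>z. f (fst z) + ?g (snd z))"
          using True by (simp add: F \<rho>_def fun_eq_iff)
        ultimately show ?thesis using True unfolding L_def pair_sums_def by auto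
      next
        case False
        then have n: "n div 2 \<in> J" using EI[OF n] by blast
        let ?f = "\<lambda>x. (f \<circ> rX (n div 2)) x - (f p + g q)"
        have "?f \<in> N"
          by (rule ranked_tree_affine[OF X N(2)[OF F(2)], where c = 1 and d = "- (f p + g q)"]) simp
        moreover have "g \<in> M\<^sub>j (n div 2)" using M(1) F n by blast
        moreover have "(\<lambda>z. F (\<rho> n z) - F (p, q)) = (\<lambda>z. ?f (fst z) + g (snd z))"
          using False by (simp add: F \<rho>_def fun_eq_iff)
        ultimately show ?thesis using False unfolding L_def pair_sums_def by auto
      qed
    next
      show "(p, q) \<in> X \<times> Y" using outer.hyps(5) inner.hyps(5) by blast
      show "X \<times> Y \<subseteq> insert (p, q) (\<Union>n\<in>E. \<rho> n ` S n)"
      proof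
        fix z assume "z \<in> X \<times> Y"
        then obtain x y where z: "z = (x, y)" "x \<in> X" "y \<in> Y" by blast
        have left: "z \<in> (\<Union>n\<in>E. \<rho> n ` S n)" if "i \<in> I" "x \<in> X\<^sub>i i" "rY i y = y" for i
        proof -
          have "2 * i \<in> E" "(x, y) \<in> S (2 * i)" "z = \<rho> (2 * i) (x, y)"
            using that z by (auto simp: E_def S_def \<rho>_def)
          then show ?thesis by blast
        qed
        have right: "z \<in> (\<Union>n\<in>E. \<rho> n ` S n)" if "j \<in> J" "y \<in> Y\<^sub>j j" "rX j x = x" for j
        proof -
          have "2 * j + 1 \<in> E" "(x, y) \<in> S (2 * j + 1)" "z = \<rho> (2 * j + 1) (x, y)"
            using that z by (auto simp: E_def S_def \<rho>_def)
          then show ?thesis by blast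
        qed
        show "z \<in> insert (p, q) (\<Union>n\<in>E. \<rho> n ` S n)"
        proof (cases "x = p"; cases "y = q")
          assume "x \<noteq> p" "y \<noteq> q"
          \<comment> \<open>The smaller index names the block: if i \<le> j, collapsing the subtrees
            of Y with index below i leaves y alone, and symmetrically.\<close>
          then obtain i j where ij: "i \<in> I" "x \<in> X\<^sub>i i" "j \<in> J" "y \<in> Y\<^sub>j j"
            using z outer.hyps(5) inner.hyps(5) by blast
          show ?thesis
            using left[OF ij(1,2) rY_id[OF ij(3,4)]] right[OF ij(3,4) rX_id[OF ij(1,2)]]
            by (cases "i \<le> j") auto
        next
          assume "x = p" "y \<noteq> q"
          then obtain j where "j \<in> J" "y \<in> Y\<^sub>j j" using z inner.hyps(5) by blast
          then show ?thesis using right \<open>x = p\<close> rp by blast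
        next
          assume "x \<noteq> p" "y = q"
          then obtain i where "i \<in> I" "x \<in> X\<^sub>i i" using z outer.hyps(5) by blast
          then show ?thesis using left \<open>y = q\<close> rp by blast
        qed (use z in auto)
      qed
      fix F and \<epsilon> :: real assume "F \<in> pair_sums N M" "0 < \<epsilon>"
      then obtain f g where F: "F = (\<lambda>z. f (fst z) + g (snd z))" "f \<in> N" "g \<in> M"
        unfolding pair_sums_def by blast
      have "0 < \<epsilon> / 2" using \<open>0 < \<epsilon>\<close> by simp
      note fin = N(3)[OF F(2) this] M(3)[OF F(3) this]
      obtain k where k: "\<And>n x. k \<le> n \<Longrightarrow> x \<in> X \<Longrightarrow> \<bar>f (rX n x) - f p\<bar> \<le> \<epsilon> / 2"
        "\<And>i x. i \<in> I \<Longrightarrow> x \<in> X\<^sub>i i \<Longrightarrow> k \<le> i \<Longrightarrow> \<bar>f x - f p\<bar> \<le> \<epsilon> / 2"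
      proof -
        obtain k where k: "\<forall>n\<ge>k. \<forall>x\<in>X. \<bar>f (rX n x) - f p\<bar> \<le> \<epsilon> / 2"
          using collapse_bound[OF fin(1) \<open>0 < \<epsilon> / 2\<close>] unfolding rX_def outer.hyps(5) by blast
        moreover from this have "\<bar>f x - f p\<bar> \<le> \<epsilon> / 2" if "i \<in> I" "x \<in> X\<^sub>i i" "k \<le> i" for i x
        proof -
          have "x \<in> X" using that outer.hyps(5) by blast
          then show ?thesis using k that(3) rX_id[OF that(1,2) order.refl] by force
        qed
        ultimately show thesis using that by blast
      qed
      obtain l where l: "\<And>n y. l \<le> n \<Longrightarrow> y \<in> Y \<Longrightarrow> \<bar>g (rY n y) - g q\<bar> \<le> \<epsilon> / 2"
        "\<And>j y. j \<in> J \<Longrightarrow> y \<in> Y\<^sub>j j \<Longrightarrow> l \<le> j \<Longrightarrow> \<bar>g y - g q\<bar> \<le> \<epsilon> / 2"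
      proof -
        obtain l where l: "\<forall>n\<ge>l. \<forall>y\<in>Y. \<bar>g (rY n y) - g q\<bar> \<le> \<epsilon> / 2"
          using collapse_bound[OF fin(2) \<open>0 < \<epsilon> / 2\<close>] unfolding rY_def inner.hyps(5) by blast
        moreover from this have "\<bar>g y - g q\<bar> \<le> \<epsilon> / 2" if "j \<in> J" "y \<in> Y\<^sub>j j" "l \<le> j" for j y
        proof -
          have "y \<in> Y" using that inner.hyps(5) by blast
          then show ?thesis using l that(3) rY_id[OF that(1,2) order.refl] by force
        qed
        ultimately show thesis using that by blast
      qed
      \<comment> \<open>Far out each coordinate contributes at most half: one because its subtree is
        late, the other because the early subtrees are collapsed.\<close>
      have "\<bar>F (\<rho> n z) - F (p, q)\<bar> \<le> \<epsilon>" if "n \<in> E" "z \<in> S n" "k \<le> n div 2" "l \<le> n div 2" for n z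
      proof (cases "even n")
        case True
        then have "\<bar>f (fst z) - f p\<bar> \<le> \<epsilon> / 2" "\<bar>g (rY (n div 2) (snd z)) - g q\<bar> \<le> \<epsilon> / 2"
          using that EI[OF that(1)] k(2)[of "n div 2"] l(1)[of "n div 2"] by (auto simp: S_def)
        moreover have "F (\<rho> n z) - F (p, q) = (f (fst z) - f p) + (g (rY (n div 2) (snd z)) - g q)"
          using True by (simp add: F \<rho>_def)
        ultimately show ?thesis by linarith
      next
        case False
        then have "\<bar>f (rX (n div 2) (fst z)) - f p\<bar> \<le> \<epsilon> / 2" "\<bar>g (snd z) - g q\<bar> \<le> \<epsilon> / 2"
          using that EI[OF that(1)] k(1)[of "n div 2"] l(2)[of "n div 2"] by (auto simp: S_def)
        moreover have "F (\<rho> n z) - F (p, q) = (f (rX (n div 2) (fst z)) - f p) + (g (snd z) - g q)"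
          using False by (simp add: F \<rho>_def)
        ultimately show ?thesis by linarith
      qed
      then have "{n \<in> E. \<exists>z\<in>S n. \<epsilon> < \<bar>F (\<rho> n z) - F (p, q)\<bar>} \<subseteq> {n. n div 2 < k \<or> n div 2 < l}"
        by (auto simp: not_le[symmetric])
      also have "\<dots> \<subseteq> {..<2 * (k + l)}" by auto
      finally show "finite {n \<in> E. \<exists>z\<in>S n. \<epsilon> < \<bar>F (\<rho> n z) - F (p, q)\<bar>}"
        using finite_subset by blast
    qed
  qed
qed


section \<open>Decomposition of ordinal intervals into blocks of small rank\<close>

text \<open>The sets \<open>{d<..c}\<close> form a neighbourhood base at c, so this is continuity on
  \<open>{a<..b}\<close> in terms of the order alone.\<close>

definition lcont :: "omega1 \<Rightarrow> omega1 \<Rightarrow> (omega1 \<Rightarrow> real) \<Rightarrow> bool" where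
  "lcont a b f \<longleftrightarrow> (\<forall>c\<in>{a<..b}. \<forall>\<epsilon>>0. \<exists>d<c. \<forall>x\<in>{d<..c}. \<bar>f x - f c\<bar> < \<epsilon>)"

lemma lcont_mono: "lcont a b f \<Longrightarrow> a \<le> a' \<Longrightarrow> b' \<le> b \<Longrightarrow> lcont a' b' f"
  unfolding lcont_def by fastforce

text \<open>Compactness by transfinite induction on the right end: near c the values differ from
  \<open>f c\<close> by less than 1, and the remaining interval ends earlier.\<close>

lemma lcont_bounded:
  assumes "lcont 0 b f"
  obtains M where "\<And>x. x \<in> {0<..b} \<Longrightarrow> \<bar>f x\<bar> \<le> M"
proof -
  have "\<exists>M. \<forall>x\<in>{0<..c}. \<bar>f x\<bar> \<le> M" if "c \<le> b" for c
    using that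
  proof (induction c rule: less_induct)
    case (less c)
    show ?case
    proof (cases "c = 0")
      case False
      then have "c \<in> {0<..b}" using less.prems by (simp add: pos_omega1_iff)
      then obtain d where d: "d < c" "\<And>x. x \<in> {d<..c} \<Longrightarrow> \<bar>f x - f c\<bar> < 1"
        using assms unfolding lcont_def by (meson zero_less_one)
      obtain M where M: "\<forall>x\<in>{0<..d}. \<bar>f x\<bar> \<le> M"
        using less d(1) by (metis less_imp_le order.trans)
      have "\<bar>f x\<bar> \<le> max M (\<bar>f c\<bar> + 1)" if "x \<in> {0<..c}" for x
      proof (cases "x \<le> d")
        case True
        then show ?thesis using M that by (simp add: le_max_iff_disj)
      next
        case False
        then have "\<bar>f x - f c\<bar> < 1" using d(2) that by auto
        then show ?thesis by linarith
      qed
      then show ?thesis by blast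
    qed simp
  qed
  then show thesis using that by blast
qed

section \<open>Cutting an interval along a cofinal sequence\<close>

locale cofinal_seq =
  fixes c :: "nat \<Rightarrow> omega1" and b :: omega1
  assumes mono: "strict_mono c" and less: "\<And>n. c n < b" and cofinal: "\<And>x. x < b \<Longrightarrow> \<exists>n. x < c n"
begin

lemma segment_subset: "{c n<..c (Suc n)} \<subseteq> {c 0<..b}"
proof
  fix x assume "x \<in> {c n<..c (Suc n)}"
  moreover have "c 0 \<le> c n" using mono by (simp add: strict_mono_less_eq)
  ultimately show "x \<in> {c 0<..b}"
    using less[of "Suc n"] order.strict_trans1[of "c 0" "c n" x] order.strict_trans1[of x "c (Suc n)" b] by auto
qed

lemma lcont_segment: "lcont (c 0) b f \<Longrightarrow> lcont (c n) (c (Suc n)) f"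
  by (rule lcont_mono) (use less[of "Suc n"] mono in \<open>auto simp: strict_mono_less_eq\<close>)

lemma segment_disjoint: "m \<noteq> n \<Longrightarrow> {c m<..c (Suc m)} \<inter> {c n<..c (Suc n)} = {}"
proof -
  have "{c m<..c (Suc m)} \<inter> {c n<..c (Suc n)} = {}" if "m < n" for m n
  proof -
    have "c (Suc m) \<le> c n" using that mono by (simp add: strict_mono_less_eq)
    then show ?thesis by auto
  qed
  then show "m \<noteq> n \<Longrightarrow> {c m<..c (Suc m)} \<inter> {c n<..c (Suc n)} = {}"
    by (metis inf_commute linorder_neqE_nat)
qed

lemma top_notin_segment: "b \<notin> {c n<..c (Suc n)}"
  using less[of "Suc n"] by auto

lemma segments_cover: "{c 0<..b} = insert b (\<Union>n. {c n<..c (Suc n)})"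
proof
  show "insert b (\<Union>n. {c n<..c (Suc n)}) \<subseteq> {c 0<..b}"
    using segment_subset less[of 0] by auto
  show "{c 0<..b} \<subseteq> insert b (\<Union>n. {c n<..c (Suc n)})"
  proof
    fix x assume x: "x \<in> {c 0<..b}"
    show "x \<in> insert b (\<Union>n. {c n<..c (Suc n)})"
    proof (cases "x = b")
      case False
      then obtain n where "x \<le> c n"
        using cofinal[of x] x less_imp_le by (metis greaterThanAtMost_iff le_less)
      define j where "j = (LEAST n. x \<le> c n)"
      have j: "x \<le> c j" unfolding j_def using \<open>x \<le> c n\<close> by (rule LeastI)
      then obtain i where i: "j = Suc i" using x by (cases j) auto
      have "c i < x" using not_less_Least[of i "\<lambda>n. x \<le> c n"] i unfolding j_def by simp
      then show ?thesis using j i by auto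
    qed simp
  qed
qed

lemma lcont_tail:
  assumes "lcont (c 0) b f" "0 < \<epsilon>"
  obtains n0 where "\<And>n x. n0 \<le> n \<Longrightarrow> x \<in> {c n<..c (Suc n)} \<Longrightarrow> \<bar>f x - f b\<bar> < \<epsilon>"
proof -
  have "b \<in> {c 0<..b}" using less by simp
  then obtain d where d: "d < b" "\<And>x. x \<in> {d<..b} \<Longrightarrow> \<bar>f x - f b\<bar> < \<epsilon>"
    using assms unfolding lcont_def by meson
  obtain n0 where n0: "d < c n0" using cofinal d(1) by blast
  show thesis
  proof (rule that)
    fix n x assume "n0 \<le> n" "x \<in> {c n<..c (Suc n)}"
    moreover have "c n0 \<le> c n" using \<open>n0 \<le> n\<close> mono by (simp add: strict_mono_less_eq)
    ultimately show "\<bar>f x - f b\<bar> < \<epsilon>"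
      using d(2)[of x] n0 less[of "Suc n"] order.strict_trans1[of x "c (Suc n)" b]
        order.strict_trans[of d "c n" x] order.strict_trans2[of d "c n0" "c n"] by auto
  qed
qed

text \<open>Continuity at b makes the differences from \<open>f b\<close> small on late segments, so
  trees inside the segments become the subtrees of a node at b. They may fill only part of a
  segment, as in \<open>oseg_block_system_step\<close>.\<close>

lemma ranked_tree_union:
  assumes tree: "\<And>n. h n < g" "\<And>n. ranked_tree (h n) (Y n) (M n)" "\<And>n. Y n \<subseteq> {c n<..c (Suc n)}"
    and M: "\<And>n f. lcont (c n) (c (Suc n)) f \<Longrightarrow> f \<in> M n"
  shows "\<exists>N. ranked_tree g (insert b (\<Union>n. Y n)) N \<and> (\<forall>f. lcont (c 0) b f \<longrightarrow> f \<in> N)"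
proof -
  let ?N = "{f. (\<forall>n\<in>UNIV. f \<in> M n) \<and> (\<forall>\<epsilon>>0. finite {n \<in> UNIV. \<exists>x\<in>Y n. \<epsilon> < \<bar>f x - f b\<bar>})}"
  have "ranked_tree g (insert b (\<Union>n. Y n)) ?N"
  proof (rule ranked_tree.node[where I = UNIV and h = h and Y = Y and M = M and p = b])
    show "b \<notin> Y n" for n using tree(3) top_notin_segment by blast
    show "Y m \<inter> Y n = {}" if "m \<noteq> n" for m n
      using tree(3)[of m] tree(3)[of n] segment_disjoint[OF that] by blast
  qed (simp_all add: tree)
  moreover have "f \<in> ?N" if f: "lcont (c 0) b f" for f
  proof -
    have "finite {n. \<exists>x\<in>Y n. \<epsilon> < \<bar>f x - f b\<bar>}" if "0 < \<epsilon>" for \<epsilon>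
    proof -
      obtain n0 where n0: "\<And>n x. n0 \<le> n \<Longrightarrow> x \<in> {c n<..c (Suc n)} \<Longrightarrow> \<bar>f x - f b\<bar> < \<epsilon>"
        using lcont_tail[OF f \<open>0 < \<epsilon>\<close>] by blast
      have "{n. \<exists>x\<in>Y n. \<epsilon> < \<bar>f x - f b\<bar>} \<subseteq> {..<n0}"
        using n0 tree(3) by (force simp: not_le[symmetric])
      then show ?thesis using finite_subset by blast
    qed
    then show ?thesis using M lcont_segment[OF f] by simp
  qed
  ultimately show ?thesis by blast
qed

end

lemma oseg_less: "oseg g a b \<Longrightarrow> a < b"
  by (induction rule: oseg.induct) auto

lemma greaterThanAtMost_osuc: "{a<..osuc a} = {osuc a}"
  by (auto simp: osuc_le_iff intro: order.antisym)

lemma oseg_ranked_tree: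
  "oseg g a b \<Longrightarrow> \<exists>N. ranked_tree g {a<..b} N \<and> (\<forall>f. lcont a b f \<longrightarrow> f \<in> N)"
proof (induction rule: oseg.induct)
  case (osuc g a)
  then show ?case using ranked_tree_leaf by (metis greaterThanAtMost_osuc UNIV_I)
next
  case (seq c b h g a)
  interpret cofinal_seq c b by unfold_locales (use seq in auto)
  obtain M where "\<And>n. ranked_tree (h n) {c n<..c (Suc n)} (M n)"
    "\<And>n f. lcont (c n) (c (Suc n)) f \<Longrightarrow> f \<in> M n"
    using seq.IH by metis
  then show ?case
    using ranked_tree_union[of h g "\<lambda>n. {c n<..c (Suc n)}" M] seq.hyps(4)
    by (simp add: segments_cover[symmetric] seq.hyps(6))
qed

section \<open>Block systems\<close>

text \<open>Blocks \<open>(Y, q)\<close> of rank below \<open>w\<close> such that a function is determined, up to the constant \<open>k\<close>,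
  by its values on \<open>X\<close> and its increments \<open>f x - f q\<close>, \<open>x \<in> Y\<close>, along the blocks.\<close>

definition block_system ::
  "omega1 \<Rightarrow> omega1 \<Rightarrow> omega1 \<Rightarrow> nat \<Rightarrow> omega1 set \<Rightarrow> (omega1 set \<times> omega1) set \<Rightarrow> bool" where
  "block_system w a b k X B \<longleftrightarrow>
     countable B \<and>
     (\<forall>(Y, q)\<in>B. Y \<subseteq> {a<..b} \<and> q \<in> {a<..b} \<and>
        (\<exists>h<w. \<exists>N. ranked_tree h Y N \<and> (\<forall>f. lcont a b f \<longrightarrow> f \<in> N))) \<and>
     (\<forall>f \<epsilon>. lcont a b f \<longrightarrow> 0 < \<epsilon> \<longrightarrow> finite {(Y, q)\<in>B. \<exists>x\<in>Y. \<epsilon> < \<bar>f x - f q\<bar>}) \<and>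
     (\<forall>f M. 0 \<le> M \<longrightarrow> (\<forall>(Y, q)\<in>B. \<forall>x\<in>Y. \<bar>f x - f q\<bar> \<le> M) \<longrightarrow>
        (\<forall>x\<in>{a<..b}. \<exists>y\<in>X. \<bar>f x - f y\<bar> \<le> real k * M))"

lemma block_systemD:
  assumes "block_system w a b k X B"
  shows "countable B"
    "(Y, q) \<in> B \<Longrightarrow> Y \<subseteq> {a<..b}" "(Y, q) \<in> B \<Longrightarrow> q \<in> {a<..b}"
    "(Y, q) \<in> B \<Longrightarrow> \<exists>h<w. \<exists>N. ranked_tree h Y N \<and> (\<forall>f. lcont a b f \<longrightarrow> f \<in> N)"
    "lcont a b f \<Longrightarrow> 0 < \<epsilon> \<Longrightarrow> finite {(Y, q)\<in>B. \<exists>x\<in>Y. \<epsilon> < \<bar>f x - f q\<bar>}"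
    "0 \<le> M \<Longrightarrow> (\<And>Y q x. (Y, q) \<in> B \<Longrightarrow> x \<in> Y \<Longrightarrow> \<bar>f x - f q\<bar> \<le> M) \<Longrightarrow> x \<in> {a<..b} \<Longrightarrow>
      \<exists>y\<in>X. \<bar>f x - f y\<bar> \<le> real k * M"
proof -
  note D = assms[unfolded block_system_def]
  show "countable B" using D by (rule conjunct1)
  show "(Y, q) \<in> B \<Longrightarrow> Y \<subseteq> {a<..b}" "(Y, q) \<in> B \<Longrightarrow> q \<in> {a<..b}"
    "(Y, q) \<in> B \<Longrightarrow> \<exists>h<w. \<exists>N. ranked_tree h Y N \<and> (\<forall>f. lcont a b f \<longrightarrow> f \<in> N)"
    using bspec[OF D[THEN conjunct2, THEN conjunct1], of "(Y, q)"] by simp_all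
  show "lcont a b f \<Longrightarrow> 0 < \<epsilon> \<Longrightarrow> finite {(Y, q)\<in>B. \<exists>x\<in>Y. \<epsilon> < \<bar>f x - f q\<bar>}"
    using D[THEN conjunct2, THEN conjunct2, THEN conjunct1] by simp
  show "\<exists>y\<in>X. \<bar>f x - f y\<bar> \<le> real k * M"
    if "0 \<le> M" "\<And>Y q x. (Y, q) \<in> B \<Longrightarrow> x \<in> Y \<Longrightarrow> \<bar>f x - f q\<bar> \<le> M" "x \<in> {a<..b}"
    by (rule D[THEN conjunct2, THEN conjunct2, THEN conjunct2, rule_format, OF that(1) _ that(3)])
      (use that(2) in auto)
qed

lemma block_systemI:
  assumes "countable B"
    "\<And>Y q. (Y, q) \<in> B \<Longrightarrow> Y \<subseteq> {a<..b} \<and> q \<in> {a<..b} \<and>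
      (\<exists>h<w. \<exists>N. ranked_tree h Y N \<and> (\<forall>f. lcont a b f \<longrightarrow> f \<in> N))"
    "\<And>f \<epsilon>. lcont a b f \<Longrightarrow> 0 < \<epsilon> \<Longrightarrow> finite {(Y, q)\<in>B. \<exists>x\<in>Y. \<epsilon> < \<bar>f x - f q\<bar>}"
    "\<And>f M x. 0 \<le> M \<Longrightarrow> (\<And>Y q x. (Y, q) \<in> B \<Longrightarrow> x \<in> Y \<Longrightarrow> \<bar>f x - f q\<bar> \<le> M) \<Longrightarrow> x \<in> {a<..b} \<Longrightarrow>
      \<exists>y\<in>X. \<bar>f x - f y\<bar> \<le> real k * M"
  shows "block_system w a b k X B"
  unfolding block_system_def
proof (intro conjI allI impI ballI)
  fix f :: "omega1 \<Rightarrow> real" and M x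
  assume "0 \<le> M" "\<forall>(Y, q)\<in>B. \<forall>x\<in>Y. \<bar>f x - f q\<bar> \<le> M" "x \<in> {a<..b}"
  then show "\<exists>y\<in>X. \<bar>f x - f y\<bar> \<le> real k * M" by (intro assms(4)) auto
qed (use assms(1-3) in auto)

lemma block_system_leaf: "block_system w a (osuc a) k {osuc a} {}"
  by (rule block_systemI) (auto simp: greaterThanAtMost_osuc)

lemma block_system_mono:
  assumes "block_system w a b k X B" "k \<le> k'"
  shows "block_system w a b k' X B"
proof (rule block_systemI)
  note D = block_systemD[OF assms(1)]
  fix f :: "omega1 \<Rightarrow> real" and M x
  assume M: "0 \<le> M" and "\<And>Y q x. (Y, q) \<in> B \<Longrightarrow> x \<in> Y \<Longrightarrow> \<bar>f x - f q\<bar> \<le> M" "x \<in> {a<..b}"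
  then obtain y where y: "y \<in> X" "\<bar>f x - f y\<bar> \<le> real k * M" using D(6) by blast
  then have "\<bar>f x - f y\<bar> \<le> real k' * M"
    using assms(2) M mult_right_mono[of "real k" "real k'" M] by simp
  then show "\<exists>y\<in>X. \<bar>f x - f y\<bar> \<le> real k' * M" using y by blast
next
  note D = block_systemD[OF assms(1)]
  show "countable B" by (rule D(1))
  show "Y \<subseteq> {a<..b} \<and> q \<in> {a<..b} \<and> (\<exists>h<w. \<exists>N. ranked_tree h Y N \<and> (\<forall>f. lcont a b f \<longrightarrow> f \<in> N))"
    if "(Y, q) \<in> B" for Y q using D(2-4)[OF that] by simp
  show "finite {(Y, q)\<in>B. \<exists>x\<in>Y. \<epsilon> < \<bar>f x - f q\<bar>}" if "lcont a b f" "0 < \<epsilon>" for f \<epsilon>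
    by (rule D(5)[OF that])
qed

text \<open>A point of X reaches X' through at most one new block, so one more increment enters the
  estimate.\<close>

lemma block_system_extend:
  assumes B: "block_system w a b k X B" and "countable B'"
    and B': "\<And>Y q. (Y, q) \<in> B' \<Longrightarrow> Y \<subseteq> {a<..b} \<and> q \<in> {a<..b} \<and>
      (\<exists>h<w. \<exists>N. ranked_tree h Y N \<and> (\<forall>f. lcont a b f \<longrightarrow> f \<in> N))"
    and fin: "\<And>f \<epsilon>. lcont a b f \<Longrightarrow> 0 < \<epsilon> \<Longrightarrow> finite {(Y, q)\<in>B'. \<exists>x\<in>Y. \<epsilon> < \<bar>f x - f q\<bar>}"
    and X': "\<And>x. x \<in> X \<Longrightarrow> x \<in> X' \<or> (\<exists>(Y, q)\<in>B'. x \<in> Y \<and> q \<in> X')"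
  shows "block_system w a b (Suc k) X' (B \<union> B')"
proof (rule block_systemI)
  note D = block_systemD[OF B]
  show "countable (B \<union> B')" using D(1) assms(2) by blast
  show "Y \<subseteq> {a<..b} \<and> q \<in> {a<..b} \<and> (\<exists>h<w. \<exists>N. ranked_tree h Y N \<and> (\<forall>f. lcont a b f \<longrightarrow> f \<in> N))"
    if "(Y, q) \<in> B \<union> B'" for Y q
    using that
  proof
    show ?thesis if "(Y, q) \<in> B" using D(2-4)[OF that] by simp
  qed (rule B')
  show "finite {(Y, q)\<in>B \<union> B'. \<exists>x\<in>Y. \<epsilon> < \<bar>f x - f q\<bar>}" if "lcont a b f" "0 < \<epsilon>" for f \<epsilon>
  proof -
    have "{(Y, q)\<in>B \<union> B'. \<exists>x\<in>Y. \<epsilon> < \<bar>f x - f q\<bar>} =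
      {(Y, q)\<in>B. \<exists>x\<in>Y. \<epsilon> < \<bar>f x - f q\<bar>} \<union> {(Y, q)\<in>B'. \<exists>x\<in>Y. \<epsilon> < \<bar>f x - f q\<bar>}" by blast
    then show ?thesis using D(5)[OF that] fin[OF that] by simp
  qed
  fix f :: "omega1 \<Rightarrow> real" and M x
  assume M: "0 \<le> M" and le: "\<And>Y q x. (Y, q) \<in> B \<union> B' \<Longrightarrow> x \<in> Y \<Longrightarrow> \<bar>f x - f q\<bar> \<le> M"
    and x: "x \<in> {a<..b}"
  obtain y where y: "y \<in> X" "\<bar>f x - f y\<bar> \<le> real k * M"
    using D(6)[OF M _ x, of f] le by blast
  have "\<exists>z\<in>X'. \<bar>f y - f z\<bar> \<le> M" using X'[OF y(1)] le M by fastforce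
  then obtain z where "z \<in> X'" "\<bar>f y - f z\<bar> \<le> M" by blast
  moreover from this y have "\<bar>f x - f z\<bar> \<le> real (Suc k) * M" by (simp add: algebra_simps)
  ultimately show "\<exists>y\<in>X'. \<bar>f x - f y\<bar> \<le> real (Suc k) * M" by blast
qed

context cofinal_seq
begin

lemma block_system_union:
  assumes B: "\<And>n. block_system w (c n) (c (Suc n)) k (X n) (B n)"
  shows "block_system w (c 0) b k (insert b (\<Union>n. X n)) (\<Union>n. B n)"
proof (rule block_systemI)
  note D = block_systemD[OF B]
  show "countable (\<Union>n. B n)" using D(1) by simp
  show "Y \<subseteq> {c 0<..b} \<and> q \<in> {c 0<..b} \<and>
      (\<exists>h<w. \<exists>N. ranked_tree h Y N \<and> (\<forall>f. lcont (c 0) b f \<longrightarrow> f \<in> N))"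
    if YB: "(Y, q) \<in> (\<Union>n. B n)" for Y q
  proof -
    obtain n where n: "(Y, q) \<in> B n" using YB by blast
    show ?thesis
      using D(2)[OF n] D(3)[OF n] D(4)[OF n] segment_subset[of n] lcont_segment by blast
  qed
  show "finite {(Y, q)\<in>\<Union>n. B n. \<exists>x\<in>Y. \<epsilon> < \<bar>f x - f q\<bar>}" if f: "lcont (c 0) b f" "0 < \<epsilon>" for f \<epsilon>
  proof -
    have "0 < \<epsilon> / 2" using f by simp
    then obtain n0 where n0: "\<And>n x. n0 \<le> n \<Longrightarrow> x \<in> {c n<..c (Suc n)} \<Longrightarrow> \<bar>f x - f b\<bar> < \<epsilon> / 2"
      using lcont_tail[OF f(1)] by blast
    \<comment> \<open>A block and its base point lie in the same segment, where for large n both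
      values are within half of \<epsilon> of \<open>f b\<close>.\<close>
    have "n < n0" if n: "(Y, q) \<in> B n" "x \<in> Y" "\<epsilon> < \<bar>f x - f q\<bar>" for Y q x n
    proof (rule ccontr)
      assume "\<not> n < n0"
      then have "\<bar>f x - f b\<bar> < \<epsilon> / 2" "\<bar>f q - f b\<bar> < \<epsilon> / 2"
        using n0[of n] n D(2)[OF n(1)] D(3)[OF n(1)] by auto
      then show False using n(3) by linarith
    qed
    then have "{(Y, q)\<in>\<Union>n. B n. \<exists>x\<in>Y. \<epsilon> < \<bar>f x - f q\<bar>} \<subseteq>
        (\<Union>n\<in>{..<n0}. {(Y, q)\<in>B n. \<exists>x\<in>Y. \<epsilon> < \<bar>f x - f q\<bar>})" by blast
    then show ?thesis
      by (rule finite_subset) (use D(5)[OF lcont_segment[OF f(1)] f(2)] in simp)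
  qed
  fix f :: "omega1 \<Rightarrow> real" and M x
  assume M: "0 \<le> M" and le: "\<And>Y q x. (Y, q) \<in> (\<Union>n. B n) \<Longrightarrow> x \<in> Y \<Longrightarrow> \<bar>f x - f q\<bar> \<le> M"
    and x: "x \<in> {c 0<..b}"
  show "\<exists>y\<in>insert b (\<Union>n. X n). \<bar>f x - f y\<bar> \<le> real k * M"
  proof (cases "x = b")
    case False
    then obtain n where n: "x \<in> {c n<..c (Suc n)}" using x unfolding segments_cover by blast
    show ?thesis using D(6)[OF M _ n, of f] le by blast
  qed (use M in simp)
qed

text \<open>Each segment top is joined to b by a singleton block, of rank 0 < w; continuity at b
  leaves finitely many large increments among these.\<close>

lemma block_system_union_tops:
  assumes B: "\<And>n. block_system w (c n) (c (Suc n)) k {c (Suc n)} (B n)" and "0 < w"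
  shows "block_system w (c 0) b (Suc k) {b} ((\<Union>n. B n) \<union> range (\<lambda>n. ({c (Suc n)}, b)))"
proof (rule block_system_extend[OF block_system_union[OF B]])
  have c: "c (Suc n) \<in> {c n<..c (Suc n)}" for n using mono by (simp add: strict_mono_less)
  have "c (Suc n) \<in> {c 0<..b}" for n by (rule subsetD[OF segment_subset c])
  moreover have "b \<in> {c 0<..b}" using less[of 0] by simp
  moreover have "\<exists>h<w. \<exists>N. ranked_tree h {c (Suc n)} N \<and> (\<forall>f. lcont (c 0) b f \<longrightarrow> f \<in> N)" for n
    using ranked_tree_leaf assms(2) UNIV_I by metis
  ultimately show "Y \<subseteq> {c 0<..b} \<and> q \<in> {c 0<..b} \<and>
      (\<exists>h<w. \<exists>N. ranked_tree h Y N \<and> (\<forall>f. lcont (c 0) b f \<longrightarrow> f \<in> N))"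
    if "(Y, q) \<in> range (\<lambda>n. ({c (Suc n)}, b))" for Y q
    using that by auto
  fix f and \<epsilon> :: real assume f: "lcont (c 0) b f" "0 < \<epsilon>"
  then obtain n0 where n0: "\<And>n x. n0 \<le> n \<Longrightarrow> x \<in> {c n<..c (Suc n)} \<Longrightarrow> \<bar>f x - f b\<bar> < \<epsilon>"
    using lcont_tail by blast
  have "n < n0" if "\<epsilon> < \<bar>f (c (Suc n)) - f b\<bar>" for n
    using n0[OF _ c, of n] that by (meson less_asym not_le)
  then have "{(Y, q)\<in>range (\<lambda>n. ({c (Suc n)}, b)). \<exists>x\<in>Y. \<epsilon> < \<bar>f x - f q\<bar>} \<subseteq>
      (\<lambda>n. ({c (Suc n)}, b)) ` {..<n0}" by auto
  then show "finite {(Y, q)\<in>range (\<lambda>n. ({c (Suc n)}, b)). \<exists>x\<in>Y. \<epsilon> < \<bar>f x - f q\<bar>}"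
    using finite_subset by blast
qed auto

end

text \<open>Subtrees of rank below l are reduced to their tops by \<open>low\<close>, while one of
  rank \<open>l + v\<close> is treated by induction with v < u; the vertices left over form a tree X
  of rank at most u.\<close>

lemma oseg_block_system_step:
  assumes low: "\<And>h a b. h < l \<Longrightarrow> oseg h a b \<Longrightarrow> \<exists>B. block_system w a b k {b} B" and "0 < w"
  shows "oseg g a b \<Longrightarrow> g \<le> l + u \<Longrightarrow> \<exists>X B N. block_system w a b (Suc k) X B \<and>
    ranked_tree u X N \<and> (\<forall>f. lcont a b f \<longrightarrow> f \<in> N) \<and> X \<subseteq> {a<..b}"
proof (induction arbitrary: u rule: oseg.induct)
  case (osuc g a)
  show ?case
    using block_system_leaf[of w a "Suc k"] ranked_tree_leaf[of u "osuc a"]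
    by (metis UNIV_I greaterThanAtMost_osuc order.refl)
next
  case (seq c b h g a)
  interpret cofinal_seq c b by unfold_locales (use seq in auto)
  have h: "h n < l + u" for n using seq.hyps(4)[of n] seq.prems by simp
  show ?case
  proof (cases "u = 0")
    \<comment> \<open>X may only be the single vertex b here, so the segment tops are joined to b by
      blocks of their own; this accounts for \<open>Suc k\<close>.\<close>
    case True
    then have "h n < l" for n using h by (simp add: plus_omega1_rec)
    then have "\<exists>B. block_system w (c n) (c (Suc n)) k {c (Suc n)} B" for n
      using low[OF _ seq.hyps(5)] by blast
    then obtain B where "\<And>n. block_system w (c n) (c (Suc n)) k {c (Suc n)} (B n)" by metis
    from block_system_union_tops[OF this \<open>0 < w\<close>] show ?thesis
      using ranked_tree_leaf[of u b] less[of 0] seq.hyps(6)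
      by (metis UNIV_I empty_subsetI greaterThanAtMost_iff insert_subset order.refl)
  next
    case False
    have "\<exists>v X B N. v < u \<and> block_system w (c n) (c (Suc n)) (Suc k) X B \<and>
      ranked_tree v X N \<and> (\<forall>f. lcont (c n) (c (Suc n)) f \<longrightarrow> f \<in> N) \<and> X \<subseteq> {c n<..c (Suc n)}" for n
      using h[of n]
    proof (rule less_plus_omega1_cases)
      assume "h n < l"
      then obtain B where "block_system w (c n) (c (Suc n)) k {c (Suc n)} B"
        using low seq.hyps(5) by blast
      then have "block_system w (c n) (c (Suc n)) (Suc k) {c (Suc n)} B"
        by (rule block_system_mono) simp
      moreover have "0 < u" using False by (simp add: pos_omega1_iff)
      moreover have "{c (Suc n)} \<subseteq> {c n<..c (Suc n)}" using mono by (simp add: strict_mono_less)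
      ultimately show ?thesis using ranked_tree_leaf UNIV_I by metis
    next
      fix v assume "v < u" "h n = l + v"
      then show ?thesis using seq.IH[of n v] by (intro exI[of _ v]) simp
    qed
    then obtain v X B N where n: "\<And>n. v n < u"
      "\<And>n. block_system w (c n) (c (Suc n)) (Suc k) (X n) (B n)" "\<And>n. ranked_tree (v n) (X n) (N n)"
      "\<And>n f. lcont (c n) (c (Suc n)) f \<Longrightarrow> f \<in> N n" "\<And>n. X n \<subseteq> {c n<..c (Suc n)}"
      by metis
    have "insert b (\<Union>n. X n) \<subseteq> {c 0<..b}"
      using n(5) unfolding segments_cover by blast
    then show ?thesis
      using block_system_union[OF n(2)] ranked_tree_union[OF n(1,3,5,4)] seq.hyps(6) by blast
  qed
qed

text \<open>A further copy of w costs two steps, one inside \<open>oseg_block_system_step\<close>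
  and one joining its tree to b. The bound k is fixed before g, a and b, since the union over
  segments requires a common one.\<close>

lemma oseg_block_system:
  assumes "0 < w"
  shows "\<exists>k. \<forall>g a b. g < omult w n \<longrightarrow> oseg g a b \<longrightarrow> (\<exists>B. block_system w a b k {b} B)"
proof (induction n)
  case (Suc n)
  then obtain k where k: "\<And>g a b. g < omult w n \<Longrightarrow> oseg g a b \<Longrightarrow> \<exists>B. block_system w a b k {b} B"
    by blast
  have "\<exists>B. block_system w a b (Suc (Suc k)) {b} B" if g: "g < omult w (Suc n)" "oseg g a b" for g a b
  proof -
    have "g < omult w n + w" using g by simp
    then show ?thesis
    proof (rule less_plus_omega1_cases)
      assume "g < omult w n"
      then show ?thesis using k[OF _ g(2)] block_system_mono[of w a b k _ _ "Suc (Suc k)"] by auto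
    next
      fix u assume u: "u < w" "g = omult w n + u"
      have "\<exists>X B N. block_system w a b (Suc k) X B \<and> ranked_tree u X N \<and>
          (\<forall>f. lcont a b f \<longrightarrow> f \<in> N) \<and> X \<subseteq> {a<..b}"
        by (rule oseg_block_system_step[of "omult w n" w k g a b u]) (use k assms g(2) u in auto)
      then obtain X B N where X: "block_system w a b (Suc k) X B" "ranked_tree u X N"
        "\<forall>f. lcont a b f \<longrightarrow> f \<in> N" "X \<subseteq> {a<..b}" by blast
      \<comment> \<open>X has rank u < w, so it is admissible as one block based at b.\<close>
      have "block_system w a b (Suc (Suc k)) {b} (B \<union> {(X, b)})"
      proof (rule block_system_extend[OF X(1)])
        show "Y \<subseteq> {a<..b} \<and> q \<in> {a<..b} \<and>
          (\<exists>h<w. \<exists>N. ranked_tree h Y N \<and> (\<forall>f. lcont a b f \<longrightarrow> f \<in> N))" if "(Y, q) \<in> {(X, b)}" for Y q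
          using that X u(1) oseg_less[OF g(2)] by auto
        show "finite {(Y, q)\<in>{(X, b)}. \<exists>x\<in>Y. \<epsilon> < \<bar>f x - f q\<bar>}" for f and \<epsilon> :: real
          by (rule finite_subset[of _ "{(X, b)}"]) auto
      qed auto
      then show ?thesis by blast
    qed
  qed
  then show ?case by blast
qed simp

text \<open>The root keeps the value at the top point, and each block records its increments.\<close>

lemma block_system_embedding:
  assumes B: "block_system w 0 b k {b} B" and "0 < b"
  obtains X :: "(nat \<times> omega1) set" and N J where "ranked_tree w X N"
    "\<And>f g c d. J (\<lambda>x. c * f x + d * g x) = (\<lambda>z. c * J f z + d * J g z)"
    "\<And>f. lcont 0 b f \<Longrightarrow> J f \<in> N"
    "\<And>f M. \<forall>x\<in>{0<..b}. \<bar>f x\<bar> \<le> M \<Longrightarrow> \<forall>z\<in>X. \<bar>J f z\<bar> \<le> 3 * M"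
    "\<And>f M. \<forall>z\<in>X. \<bar>J f z\<bar> \<le> M \<Longrightarrow> \<forall>x\<in>{0<..b}. \<bar>f x\<bar> \<le> (2 * real k + 1) * M"
proof -
  note D = block_systemD[OF B]
  define e where "e = to_nat_on B"
  define I where "I = e ` B"
  define Y where "Y n = fst (inv_into B e n)" for n
  define q where "q n = snd (inv_into B e n)" for n
  have inj: "inj_on e B" unfolding e_def using D(1) by (rule inj_on_to_nat_on)
  have YB: "(Y n, q n) \<in> B" if "n \<in> I" for n
    using inv_into_into[of n e B] that unfolding I_def Y_def q_def by simp
  have BY: "Y (e (Z, r)) = Z" "q (e (Z, r)) = r" "e (Z, r) \<in> I" if "(Z, r) \<in> B" for Z r
    using that inj unfolding Y_def q_def I_def by simp_all
  have "\<exists>h N. h < w \<and> ranked_tree h (Y n) N \<and> (\<forall>f. lcont 0 b f \<longrightarrow> f \<in> N)" if "n \<in> I" for n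
    using D(4)[OF YB[OF that]] by blast
  then obtain h L where L: "\<And>n. n \<in> I \<Longrightarrow> h n < w" "\<And>n. n \<in> I \<Longrightarrow> ranked_tree (h n) (Y n) (L n)"
    "\<And>n f. n \<in> I \<Longrightarrow> lcont 0 b f \<Longrightarrow> f \<in> L n" by metis
  \<comment> \<open>First coordinate 0 is reserved for the root, hence the tags \<open>Suc n\<close>
    for blocks and \<open>fst z - 1\<close> in \<open>J\<close>.\<close>
  let ?p = "(0, 0) :: nat \<times> omega1"
  let ?Y = "\<lambda>n. Pair (Suc n) ` Y n"
  let ?M = "\<lambda>n. {f. f \<circ> Pair (Suc n) \<in> L n}"
  let ?X = "insert ?p (\<Union>n\<in>I. ?Y n)"
  let ?N = "{f. (\<forall>n\<in>I. f \<in> ?M n) \<and> (\<forall>\<epsilon>>0. finite {n \<in> I. \<exists>x\<in>?Y n. \<epsilon> < \<bar>f x - f ?p\<bar>})}"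
  \<comment> \<open>Adding \<open>f b\<close> makes the difference from the root value exactly the
    increment along the block.\<close>
  define J where "J f z = (if fst z = 0 then f b else f b + f (snd z) - f (q (fst z - 1)))"
    for f :: "omega1 \<Rightarrow> real" and z :: "nat \<times> omega1"
  have J: "J f ?p = f b" "J f (Suc n, x) = f b + f x - f (q n)" for f n x by (simp_all add: J_def)
  have top: "b \<in> {0<..b}" using assms(2) by simp
  show thesis
  proof (rule that[of ?X ?N J])
    show "ranked_tree w ?X ?N"
    proof (rule ranked_tree.node[where I = I and h = h and Y = ?Y and M = ?M and p = ?p])
      show "ranked_tree (h n) (?Y n) (?M n)" if "n \<in> I" for n
        by (rule ranked_tree_image[OF L(2)[OF that]]) (simp add: inj_def)
    qed (use L in auto)
    show "J (\<lambda>x. c * f x + d * g x) = (\<lambda>z. c * J f z + d * J g z)" for f g c d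
      by (auto simp: J_def fun_eq_iff algebra_simps)
    show "J f \<in> ?N" if f: "lcont 0 b f" for f
    proof -
      have "J f \<circ> Pair (Suc n) \<in> L n" if "n \<in> I" for n
        by (rule ranked_tree_affine[OF L(2)[OF that] L(3)[OF that f], where c = 1 and d = "f b - f (q n)"])
          (simp add: J)
      moreover have "finite {n \<in> I. \<exists>x\<in>?Y n. \<epsilon> < \<bar>J f x - J f ?p\<bar>}" if "0 < \<epsilon>" for \<epsilon>
      proof -
        have "{n \<in> I. \<exists>x\<in>?Y n. \<epsilon> < \<bar>J f x - J f ?p\<bar>} \<subseteq> e ` {(Z, r)\<in>B. \<exists>x\<in>Z. \<epsilon> < \<bar>f x - f r\<bar>}"
        proof
          fix n assume "n \<in> {n \<in> I. \<exists>x\<in>?Y n. \<epsilon> < \<bar>J f x - J f ?p\<bar>}"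
          then have n: "n \<in> I" "\<exists>x\<in>Y n. \<epsilon> < \<bar>f x - f (q n)\<bar>" by (auto simp: J)
          then have "e (Y n, q n) = n" unfolding Y_def q_def I_def by (simp add: f_inv_into_f)
          then show "n \<in> e ` {(Z, r)\<in>B. \<exists>x\<in>Z. \<epsilon> < \<bar>f x - f r\<bar>}"
            using n YB[OF n(1)] by (intro image_eqI[of _ _ "(Y n, q n)"]) auto
        qed
        then show ?thesis using D(5)[OF f that] finite_surj by blast
      qed
      ultimately show ?thesis by simp
    qed
    show "\<forall>z\<in>?X. \<bar>J f z\<bar> \<le> 3 * M" if M: "\<forall>x\<in>{0<..b}. \<bar>f x\<bar> \<le> M" for f M
    proof (intro ballI, elim insertE)
      fix z
      assume "z = ?p"
      then show "\<bar>J f z\<bar> \<le> 3 * M" using bspec[OF M top] by (simp add: J)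
    next
      fix z assume "z \<in> (\<Union>n\<in>I. ?Y n)"
      then obtain n x where n: "n \<in> I" "x \<in> Y n" "z = (Suc n, x)" by blast
      then have "\<bar>f x\<bar> \<le> M" "\<bar>f (q n)\<bar> \<le> M" using M D(2,3)[OF YB[OF n(1)]] by blast+
      then show "\<bar>J f z\<bar> \<le> 3 * M" using bspec[OF M top] n(3) by (simp add: J)
    qed
    show "\<forall>x\<in>{0<..b}. \<bar>f x\<bar> \<le> (2 * real k + 1) * M" if M: "\<forall>z\<in>?X. \<bar>J f z\<bar> \<le> M" for f M
    proof
      fix x assume x: "x \<in> {0<..b}"
      have fb: "\<bar>f b\<bar> \<le> M" using bspec[OF M, of ?p] by (simp add: J)
      \<comment> \<open>An increment is a block value minus the root value, hence at most 2 M; k of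
        them and the value at b give the factor 2 k + 1.\<close>
      have "\<bar>f x - f r\<bar> \<le> 2 * M" if "(Z, r) \<in> B" "x \<in> Z" for Z r x
      proof -
        have "(Suc (e (Z, r)), x) \<in> ?X" using BY[OF that(1)] that(2) by blast
        then show ?thesis using bspec[OF M, of "(Suc (e (Z, r)), x)"] fb BY[OF that(1)] by (simp add: J)
      qed
      then have "\<bar>f x - f b\<bar> \<le> real k * (2 * M)"
        using D(6)[of "2 * M" f x] x fb by auto
      then show "\<bar>f x\<bar> \<le> (2 * real k + 1) * M" using fb by (simp add: algebra_simps)
    qed
  qed
qed


section \<open>Averages over pairs and phase retrieval\<close>

lemma supnorm_ge:
  assumes "\<And>x. x \<in> topspace X \<Longrightarrow> \<bar>f x\<bar> \<le> M" "x \<in> topspace X"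
  shows "\<bar>f x\<bar> \<le> supnorm X f"
  unfolding supnorm_def using assms by (intro cSUP_upper bdd_aboveI2) auto

lemma supnorm_le:
  assumes "topspace X \<noteq> {}" "\<And>x. x \<in> topspace X \<Longrightarrow> \<bar>f x\<bar> \<le> M"
  shows "supnorm X f \<le> M"
  unfolding supnorm_def using assms by (intro cSUP_least) auto

lemma cspace_linear: "f \<in> cspace X \<Longrightarrow> g \<in> cspace X \<Longrightarrow> (\<lambda>x. a * f x + b * g x) \<in> cspace X"
  unfolding cspace_def by (auto intro!: continuous_intros continuous_map_real_mult)

lemma abs_diff_abs_eq_min: "\<bar>\<bar>u\<bar> - \<bar>v\<bar>\<bar> = min \<bar>u - v\<bar> \<bar>u + v :: real\<bar>"
  by (auto simp: min_def abs_if)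

text \<open>The case s = t shows that T f takes every value of f on X, so suprema over X are
  preserved; distinct s and t serve phase retrieval.\<close>

definition averaging ::
  "'a topology \<Rightarrow> 'b set \<Rightarrow> ('b \<Rightarrow> real) set \<Rightarrow> (('b \<Rightarrow> real) \<Rightarrow> 'a \<Rightarrow> real) \<Rightarrow> bool" where
  "averaging K X N T \<longleftrightarrow>
     (\<forall>f g c d. T (\<lambda>x. c * f x + d * g x) = (\<lambda>y. c * T f y + d * T g y)) \<and>
     (\<forall>f\<in>N. T f \<in> cspace K) \<and>
     (\<forall>f M y. (\<forall>x\<in>X. \<bar>f x\<bar> \<le> M) \<longrightarrow> \<bar>T f y\<bar> \<le> M) \<and>
     (\<forall>s\<in>X. \<forall>t\<in>X. \<exists>y\<in>topspace K. \<forall>f. T f y = (f s + f t) / 2)"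

lemma averagingD:
  assumes "averaging K X N T"
  shows "T (\<lambda>x. c * f x + d * g x) = (\<lambda>y. c * T f y + d * T g y)"
    and "f \<in> N \<Longrightarrow> T f \<in> cspace K"
    and "(\<And>x. x \<in> X \<Longrightarrow> \<bar>f x\<bar> \<le> M) \<Longrightarrow> \<bar>T f y\<bar> \<le> M"
    and "s \<in> X \<Longrightarrow> t \<in> X \<Longrightarrow> \<exists>y\<in>topspace K. \<forall>f. T f y = (f s + f t) / 2"
  using assms unfolding averaging_def by simp_all

text \<open>\<open>ranked_tree_prod_embeds\<close> is used for two copies of X with the whole of K
  as open set, and its operator is applied to the averages.\<close>

lemma averaging_exists:
  assumes K: "compact_space K" "Hausdorff_space K" and "cb_derivative K a \<noteq> {}"
    and X: "ranked_tree g X N" and "nsum g g a"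
  shows "\<exists>T. averaging K X N T"
proof -
  have "embeds_at_rank K a (X \<times> X) (pair_sums N N)"
    by (rule ranked_tree_prod_embeds[OF K X X assms(5)])
  moreover have "topspace K \<inter> cb_derivative K a \<noteq> {}"
    using assms(3) cb_derivative_subset_topspace[of K a] by blast
  ultimately obtain T where T: "sub_copy K (topspace K) (X \<times> X) (pair_sums N N) T"
    unfolding embeds_at_rank_def by blast
  note D = sub_copyD[OF T]
  define A where "A f z = (f (fst z) + f (snd z)) / 2" for f :: "'b \<Rightarrow> real" and z
  have "averaging K X N (\<lambda>f. T (A f))"
    unfolding averaging_def
  proof (intro conjI allI ballI impI)
    show "T (A (\<lambda>x. c * f x + d * g x)) = (\<lambda>y. c * T (A f) y + d * T (A g) y)" for f g c d
    proof
      fix y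
      have "A (\<lambda>x. c * f x + d * g x) = (\<lambda>z. c * A f z + d * A g z)"
        by (simp add: A_def fun_eq_iff field_simps)
      then show "T (A (\<lambda>x. c * f x + d * g x)) y = c * T (A f) y + d * T (A g) y"
        by (simp add: D(1))
    qed
    show "T (A f) \<in> cspace K" if "f \<in> N" for f
    proof -
      have "(\<lambda>x. f x / 2) \<in> N"
        by (rule ranked_tree_affine[OF X that, where c = "1 / 2" and d = 0]) simp
      then have "A f \<in> pair_sums N N"
        unfolding pair_sums_def A_def by (force simp: add_divide_distrib)
      then show ?thesis using D(2,5) unfolding cspace_def by blast
    qed
    show "\<bar>T (A f) y\<bar> \<le> M" if M: "\<forall>x\<in>X. \<bar>f x\<bar> \<le> M" for f M y
    proof (cases "X = {}")
      case True
      then show ?thesis using X by (auto elim: ranked_tree.cases)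
    next
      case False
      then have "0 \<le> M" using M by force
      have "\<bar>A f z\<bar> \<le> M" if "z \<in> X \<times> X" for z
      proof -
        have "\<bar>f (fst z)\<bar> \<le> M" "\<bar>f (snd z)\<bar> \<le> M" using M that by auto
        then show ?thesis
          using abs_triangle_ineq[of "f (fst z)" "f (snd z)"] by (simp add: A_def)
      qed
      then have "\<bar>T (A f) y\<bar> \<le> M * T (\<lambda>_. 1) y" by (rule D(4))
      also have "\<dots> \<le> M" using mult_left_mono[OF D(3) \<open>0 \<le> M\<close>] by simp
      finally show ?thesis .
    qed
    show "\<exists>y\<in>topspace K. \<forall>f. T (A f) y = (f s + f t) / 2" if "s \<in> X" "t \<in> X" for s t
    proof -
      obtain y where "y \<in> topspace K" "\<And>f. T f y = f (s, t)" using D(6)[of "(s, t)"] \<open>s \<in> X\<close> \<open>t \<in> X\<close> by blast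
      then show ?thesis by (intro bexI[of _ y]) (simp_all add: A_def)
    qed
  qed
  then show ?thesis by blast
qed

text \<open>\<open>J\<close> is the identity for the isometric copy and the passage to increments
  for the isomorphic one. A bound on X for the image under \<open>J\<close> of f - g or f + g
  carries over to K through T.\<close>

lemma averaging_SPR:
  assumes T: "averaging K X N T" and K: "topspace K \<noteq> {}"
    and J: "\<And>f g c d. J (\<lambda>x. c * f x + d * g x) = (\<lambda>z. c * J f z + d * J g z)"
      "\<And>f. f \<in> cspace L \<Longrightarrow> J f \<in> N"
      "\<And>f. f \<in> cspace L \<Longrightarrow> \<exists>M. \<forall>x\<in>X. \<bar>J f x\<bar> \<le> M"
  shows "linear_cspace L K (\<lambda>f. T (J f))" "does_SPR K ((\<lambda>f. T (J f)) ` cspace L)"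
proof -
  let ?S = "\<lambda>f. T (J f)"
  have lin: "?S (\<lambda>x. c * f x + d * g x) = (\<lambda>y. c * ?S f y + d * ?S g y)" for f g c d
    by (simp add: J(1) averagingD(1)[OF T])
  have S: "?S ` cspace L \<subseteq> cspace K" using J(2) averagingD(2)[OF T] by blast
  show "linear_cspace L K ?S" unfolding linear_cspace_def using lin S by blast
  have zero: "(\<lambda>_. 0) \<in> cspace L" by (simp add: cspace_def)
  have "?S (\<lambda>_. 0) = (\<lambda>_. 0)" using lin[of 0 "\<lambda>_. 0" 0 "\<lambda>_. 0"] by simp
  then have "(\<lambda>_. 0) \<in> ?S ` cspace L" using zero by (metis image_eqI)
  moreover have "(\<lambda>x. a * u x + b * v x) \<in> ?S ` cspace L"
    if "u \<in> ?S ` cspace L" "v \<in> ?S ` cspace L" for u v a b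
    using that by (auto simp flip: lin intro!: imageI cspace_linear)
  ultimately have subspace: "cspace_subspace K (?S ` cspace L)"
    unfolding cspace_subspace_def using S by blast
  have "min (supnorm K (\<lambda>x. u x - v x)) (supnorm K (\<lambda>x. u x + v x))
      \<le> 3 * supnorm K (\<lambda>x. \<bar>u x\<bar> - \<bar>v x\<bar>)" if uv: "u \<in> ?S ` cspace L" "v \<in> ?S ` cspace L" for u v
  proof -
    obtain f g where fg: "f \<in> cspace L" "g \<in> cspace L" "u = ?S f" "v = ?S g" using uv by blast
    define p where "p = J (\<lambda>x. f x - g x)"
    define q where "q = J (\<lambda>x. f x + g x)"
    define D where "D = supnorm K (\<lambda>x. \<bar>u x\<bar> - \<bar>v x\<bar>)"
    have Tp: "T p y = u y - v y" and Tq: "T q y = u y + v y" for y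
      using lin[of 1 f "-1" g] lin[of 1 f 1 g] by (auto simp: p_def q_def fg fun_eq_iff)
    obtain Mf Mg where M: "\<And>x. x \<in> X \<Longrightarrow> \<bar>J f x\<bar> \<le> Mf" "\<And>x. x \<in> X \<Longrightarrow> \<bar>J g x\<bar> \<le> Mg"
      using J(3)[OF fg(1)] J(3)[OF fg(2)] by blast
    have le: "\<bar>u y\<bar> \<le> Mf" "\<bar>v y\<bar> \<le> Mg" for y
      unfolding fg(3,4) by (rule averagingD(3)[OF T]; rule M; assumption)+
    \<comment> \<open>Boundedness lets \<open>supnorm\<close>, a conditional supremum, dominate the
      values.\<close>
    have "\<bar>\<bar>u y\<bar> - \<bar>v y\<bar>\<bar> \<le> Mf + Mg" for y
      using le[of y] by linarith
    then have D: "min \<bar>T p y\<bar> \<bar>T q y\<bar> \<le> D" if "y \<in> topspace K" for y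
      using supnorm_ge[of K "\<lambda>x. \<bar>u x\<bar> - \<bar>v x\<bar>" "Mf + Mg" y] that
      unfolding D_def Tp Tq abs_diff_abs_eq_min by blast
    have avg: "min \<bar>(p s + p t) / 2\<bar> \<bar>(q s + q t) / 2\<bar> \<le> D" if "s \<in> X" "t \<in> X" for s t
      using averagingD(4)[OF T that] D by metis
    have "(\<forall>s\<in>X. \<bar>p s\<bar> \<le> 3 * D) \<or> (\<forall>t\<in>X. \<bar>q t\<bar> \<le> 3 * D)"
    proof (rule ccontr)
      assume "\<not> ?thesis"
      then obtain s t where st: "s \<in> X" "3 * D < \<bar>p s\<bar>" "t \<in> X" "3 * D < \<bar>q t\<bar>" by (meson not_le)
      have "0 \<le> D" using avg[OF st(1) st(1)] by linarith
      then show False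
        using avg[OF st(1) st(1)] avg[OF st(3) st(3)] avg[OF st(1) st(3)] st(2,4)
        by (simp add: min_le_iff_disj) argo
    qed
    then have "(\<forall>y. \<bar>u y - v y\<bar> \<le> 3 * D) \<or> (\<forall>y. \<bar>u y + v y\<bar> \<le> 3 * D)"
      using averagingD(3)[OF T, of p "3 * D"] averagingD(3)[OF T, of q "3 * D"]
      unfolding Tp Tq by blast
    then have "supnorm K (\<lambda>x. u x - v x) \<le> 3 * D \<or> supnorm K (\<lambda>x. u x + v x) \<le> 3 * D"
      using supnorm_le[OF K, of "\<lambda>x. u x - v x" "3 * D"] supnorm_le[OF K, of "\<lambda>x. u x + v x" "3 * D"] by blast
    then show ?thesis unfolding D_def by (simp add: min_le_iff_disj)
  qed
  then have "does_C_SPR K 3 (?S ` cspace L)"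
    unfolding does_C_SPR_def using subspace by blast
  then show "does_SPR K (?S ` cspace L)"
    unfolding does_SPR_def by (intro exI[of _ 3]) simp
qed

section \<open>Continuous functions on ordinal intervals and the two kinds of copies\<close>

lemma topspace_ord_interval: "topspace (ord_interval b) = {0<..b}"
  by (auto simp: ord_interval_def one_omega1_def osuc_le_iff)

lemma cspace_ord_interval_lcont:
  assumes "f \<in> cspace (ord_interval b)"
  shows "lcont 0 b f"
  unfolding lcont_def
proof (intro ballI allI impI)
  fix c and \<epsilon> :: real assume c: "c \<in> {0<..b}" and "0 < \<epsilon>"
  have "continuous_on {0<..b} f"
    using assms topspace_ord_interval[of b] unfolding cspace_def ord_interval_def by auto
  moreover have "open (ball (f c) \<epsilon>)" "f c \<in> ball (f c) \<epsilon>" using \<open>0 < \<epsilon>\<close> by auto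
  ultimately obtain A where A: "open A" "c \<in> A" "\<forall>x\<in>{0<..b}. x \<in> A \<longrightarrow> f x \<in> ball (f c) \<epsilon>"
    using c unfolding continuous_on_topological by meson
  obtain d where d: "d < c" "{d<..c} \<subseteq> A" using open_left[OF A(1,2), of 0] c by auto
  have "\<bar>f x - f c\<bar> < \<epsilon>" if "x \<in> {d<..c}" for x
  proof -
    have "0 < x" using that by (auto intro: order.strict_trans1[OF zero_le_omega1])
    then have "f x \<in> ball (f c) \<epsilon>" using A(3) d(2) that c by fastforce
    then show ?thesis by (simp add: dist_real_def abs_minus_commute)
  qed
  then show "\<exists>d<c. \<forall>x\<in>{d<..c}. \<bar>f x - f c\<bar> < \<epsilon>" using d(1) by blast
qed

lemma cspace_ord_interval_bounded:
  assumes "f \<in> cspace (ord_interval b)" "x \<in> {0<..b}"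
  shows "\<bar>f x\<bar> \<le> supnorm (ord_interval b) f"
  using lcont_bounded[OF cspace_ord_interval_lcont[OF assms(1)]] supnorm_ge[of "ord_interval b" f]
    assms(2) unfolding topspace_ord_interval by metis

lemma isometric_SPR_copy:
  assumes T: "averaging K {0<..b} N T" and K: "topspace K \<noteq> {}" and "0 < b"
    and N: "\<And>f. lcont 0 b f \<Longrightarrow> f \<in> N"
  shows "has_isometric_SPR_copy K (ord_interval b)"
proof -
  let ?L = "ord_interval b"
  have bdd: "\<And>x. x \<in> {0<..b} \<Longrightarrow> \<bar>f x\<bar> \<le> supnorm ?L f" if "f \<in> cspace ?L" for f
    using cspace_ord_interval_bounded[OF that] .
  have SPR: "linear_cspace ?L K T" "does_SPR K (T ` cspace ?L)"
    using averaging_SPR[OF T K, of "\<lambda>f. f" ?L] N cspace_ord_interval_lcont bdd by blast+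
  have "supnorm K (T f) = supnorm ?L f" if f: "f \<in> cspace ?L" for f
  proof (rule antisym)
    have le: "\<bar>T f y\<bar> \<le> supnorm ?L f" for y by (rule averagingD(3)[OF T bdd[OF f]])
    then show "supnorm K (T f) \<le> supnorm ?L f" by (intro supnorm_le K)
    show "supnorm ?L f \<le> supnorm K (T f)"
    proof (rule supnorm_le)
      show "topspace ?L \<noteq> {}" using \<open>0 < b\<close> by (auto simp: topspace_ord_interval)
      fix x assume "x \<in> topspace ?L"
      then obtain y where "y \<in> topspace K" "T f y = f x"
        using averagingD(4)[OF T, of x x] by (auto simp: topspace_ord_interval)
      then show "\<bar>f x\<bar> \<le> supnorm K (T f)" using supnorm_ge[of K "T f", OF le] by metis
    qed
  qed
  then show ?thesis
    unfolding has_isometric_SPR_copy_def isometric_embedding_def using SPR by blast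
qed

text \<open>As T preserves suprema over X, the two estimates for \<open>J\<close> become estimates
  for the composite.\<close>

lemma isomorphic_SPR_copy:
  assumes T: "averaging K X N T" and K: "topspace K \<noteq> {}" and "0 < b"
    and J: "\<And>f g c d. J (\<lambda>x. c * f x + d * g x) = (\<lambda>z. c * J f z + d * J g z)"
      "\<And>f. lcont 0 b f \<Longrightarrow> J f \<in> N"
    and upper: "\<And>f M. \<forall>x\<in>{0<..b}. \<bar>f x\<bar> \<le> M \<Longrightarrow> \<forall>z\<in>X. \<bar>J f z\<bar> \<le> C * M"
    and lower: "\<And>f M. \<forall>z\<in>X. \<bar>J f z\<bar> \<le> M \<Longrightarrow> \<forall>x\<in>{0<..b}. \<bar>f x\<bar> \<le> C' * M"
  shows "has_isomorphic_SPR_copy K (ord_interval b)"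
proof -
  let ?L = "ord_interval b" and ?S = "\<lambda>f. T (J f)"
  have J_le: "\<bar>J f z\<bar> \<le> C * supnorm ?L f" if "f \<in> cspace ?L" "z \<in> X" for f z
    using upper cspace_ord_interval_bounded[OF that(1)] that(2) by blast
  have SPR: "linear_cspace ?L K ?S" "does_SPR K (?S ` cspace ?L)"
    using averaging_SPR[OF T K, of J ?L] J cspace_ord_interval_lcont J_le by blast+
  have S_le: "\<bar>?S f y\<bar> \<le> C * supnorm ?L f" if "f \<in> cspace ?L" for f y
    using J_le[OF that] by (rule averagingD(3)[OF T])
  have bound: "\<bar>f x\<bar> \<le> C' * supnorm K (?S f)" if f: "f \<in> cspace ?L" and x: "x \<in> {0<..b}" for f x
  proof (rule lower[rule_format, OF _ x])
    fix z assume "z \<in> X"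
    then obtain y where "y \<in> topspace K" "?S f y = J f z"
      using averagingD(4)[OF T, of z z] by auto
    then show "\<bar>J f z\<bar> \<le> supnorm K (?S f)" using supnorm_ge[of K "?S f", OF S_le[OF f]] by metis
  qed
  have inj: "inj_on ?S (cspace ?L)"
  proof
    fix f g assume fg: "f \<in> cspace ?L" "g \<in> cspace ?L" "?S f = ?S g"
    \<comment> \<open>Written in the form to which linearity applies; the lower estimate then forces
      this difference to vanish on the interval.\<close>
    let ?h = "\<lambda>x. 1 * f x + (- 1) * g x"
    have h: "?h \<in> cspace ?L" by (rule cspace_linear[OF fg(1,2)])
    have "?S ?h = (\<lambda>y. 0)" by (simp only: J(1) averagingD(1)[OF T] fg(3)) simp
    then have "supnorm K (?S ?h) = 0" using K by (simp add: supnorm_def)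
    then have eq: "f x = g x" if "x \<in> {0<..b}" for x using bound[OF h that] by simp
    show "f = g"
    proof
      fix x
      show "f x = g x"
      proof (cases "x \<in> {0<..b}")
        case False
        then have "x \<notin> topspace ?L" by (simp add: topspace_ord_interval)
        then show ?thesis using fg(1,2) unfolding cspace_def by simp
      qed (rule eq)
    qed
  qed
  have "\<exists>M. \<forall>f\<in>cspace ?L. supnorm K (?S f) \<le> M * supnorm ?L f"
    by (intro exI[of _ C] ballI supnorm_le[OF K] S_le)
  moreover have "\<exists>M. \<forall>h\<in>?S ` cspace ?L. supnorm ?L (inv_into (cspace ?L) ?S h) \<le> M * supnorm K h"
  proof (intro exI ballI)
    fix h assume "h \<in> ?S ` cspace ?L"
    then obtain f where f: "f \<in> cspace ?L" "h = ?S f" by blast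
    have "topspace ?L \<noteq> {}" using \<open>0 < b\<close> by (auto simp: topspace_ord_interval)
    then have "supnorm ?L f \<le> C' * supnorm K (?S f)"
      using bound[OF f(1)] by (intro supnorm_le) (auto simp: topspace_ord_interval)
    then show "supnorm ?L (inv_into (cspace ?L) ?S h) \<le> C' * supnorm K h"
      using inv_into_f_f[OF inj f(1)] f(2) by simp
  qed
  ultimately show ?thesis
    unfolding has_isomorphic_SPR_copy_def isomorphic_embedding_def using SPR inj by blast
qed

theorem corollary3p6:
  fixes K :: "'a topology" and \<alpha> \<beta> :: omega1
  assumes "compact_space K" and "Hausdorff_space K"
    and "0 < \<alpha>" and "cb_derivative K \<alpha> \<noteq> {}"
    and "omega_pow \<beta> \<le> \<alpha>" and "\<alpha> < omega_pow (\<beta> + 1)"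
  shows "(\<forall>\<gamma><omega_pow \<beta>. has_isometric_SPR_copy K (ord_interval (omega_pow \<gamma>))) \<and>
         (omega_pow \<beta> * (1 + 1) \<le> \<alpha> \<longrightarrow>
            has_isomorphic_SPR_copy K (ord_interval (omega_pow \<alpha>)))"
proof (intro conjI allI impI)
  have K: "topspace K \<noteq> {}" using assms(4) cb_derivative_subset_topspace[of K \<alpha>] by blast
  have derivative: "cb_derivative K a \<noteq> {}" if "a \<le> \<alpha>" for a
    using assms(4) cb_derivative_antimono[OF that, of K] by blast
  fix \<gamma> assume "\<gamma> < omega_pow \<beta>"
  \<comment> \<open>The rank of the square stays below \<open>omega_pow \<beta>\<close>, hence below
    \<alpha>, so that derivative of K is nonempty.\<close>
  then obtain a where a: "a < omega_pow \<beta>" "nsum \<gamma> \<gamma> a" using nsum_closed_omega_pow by blast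
  obtain N where N: "ranked_tree \<gamma> {0<..omega_pow \<gamma>} N" "\<forall>f. lcont 0 (omega_pow \<gamma>) f \<longrightarrow> f \<in> N"
    using oseg_ranked_tree[OF oseg_omega_pow] by blast
  have "a \<le> \<alpha>" using a(1) assms(5) by simp
  then obtain T where "averaging K {0<..omega_pow \<gamma>} N T"
    using averaging_exists[OF assms(1,2) derivative N(1) a(2)] by blast
  then show "has_isometric_SPR_copy K (ord_interval (omega_pow \<gamma>))"
    using isometric_SPR_copy K omega_pow_pos N(2) by blast
next
  assume le: "omega_pow \<beta> * (1 + 1) \<le> \<alpha>"
  let ?w = "omega_pow \<beta>" and ?b = "omega_pow \<alpha>"
  have K: "topspace K \<noteq> {}" using assms(4) cb_derivative_subset_topspace[of K \<alpha>] by blast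
  have derivative: "cb_derivative K (?w * (1 + 1)) \<noteq> {}"
    using assms(4) cb_derivative_antimono[OF le, of K] by blast
  \<comment> \<open>A finite multiple of \<open>omega_pow \<beta>\<close> exceeds \<alpha>, which
    bounds the number of blocks on the way to the top.\<close>
  obtain n where "\<alpha> < omult ?w n"
    using assms(6) unfolding osuc_eq_plus_1[symmetric] less_omega_pow_osuc_iff by blast
  then obtain k B where B: "block_system ?w 0 ?b k {?b} B"
    using oseg_block_system[OF omega_pow_pos] oseg_omega_pow by blast
  show "has_isomorphic_SPR_copy K (ord_interval ?b)"
  proof (rule block_system_embedding[OF B omega_pow_pos])
    fix X :: "(nat \<times> omega1) set" and N J
    assume J: "ranked_tree ?w X N"
      "\<And>f g c d. J (\<lambda>x. c * f x + d * g x) = (\<lambda>z. c * J f z + d * J g z)"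
      "\<And>f. lcont 0 ?b f \<Longrightarrow> J f \<in> N"
      "\<And>f M. \<forall>x\<in>{0<..?b}. \<bar>f x\<bar> \<le> M \<Longrightarrow> \<forall>z\<in>X. \<bar>J f z\<bar> \<le> 3 * M"
      "\<And>f M. \<forall>z\<in>X. \<bar>J f z\<bar> \<le> M \<Longrightarrow> \<forall>x\<in>{0<..?b}. \<bar>f x\<bar> \<le> (2 * real k + 1) * M"
    \<comment> \<open>The increments live on a tree of rank \<open>omega_pow \<beta>\<close>; its
      square has rank at most twice that, which the derivative of K reaches by assumption.\<close>
    obtain T where "averaging K X N T"
      using averaging_exists[OF assms(1,2) derivative J(1) nsum_omega_pow_double] by blast
    then show ?thesis by (rule isomorphic_SPR_copy[OF _ K omega_pow_pos J(2-5)])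
  qed
qed

end
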